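(* Let $n \ge 2$ be an integer and let $\emptyset \ne P \subseteq \{1,\dots,n-1\}$. The following are equivalent. (1) For every $n\times n$ partial symmetric Toeplitz matrix $\mathcal{T}$ with pattern $P$ that is positive definite completable, the maximum determinant completion $T^{\star}$ of $\mathcal{T}$ is a Toeplitz matrix. (2) There exist positive integers $r,k$ such that $P$ has one of the following three forms: - $P = \{k,2k,\dots,rk\}$; - $P = \{k,2k,\dots,(r-2)k,rk\}$, where $n=(r+1)k$; - $P = \{k,n-k\}$.
   Context: All matrices are real. A symmetric $n\times n$ matrix $T$ is Toeplitz if there are reals $t_0,\dots,t_{n-1}$ with $T_{ij}=t_{|i-j|}$ for all $i,j$. For $P\subseteq\{1,\dots,n-1\}$, an $n\times n$ partial symmetric Toeplitz matrix $\mathcal{T}$ with pattern $P$ is given by real data $\{t_k : k\in P\cup\{0\}\}$: the entries $(i,j)$ with $|i-j|\in P\cup\{0\}$ are specified and equal to $t_{|i-j|}$ (the main diagonal is always specified), and all other entries are unspecified. A completion of $\mathcal{T}$ is a (fully specified) symmetric $n\times n$ matrix, not necessarily Toeplitz, that agrees with $\mathcal{T}$ on all specified entries. $\mathcal{T}$ is positive definite completable if it has a positive definite completion; in that case $T^{\star}$ denotes the unique positive definite completion of $\mathcal{T}$ that maximizes the determinant over all positive definite completions of $\mathcal{T}$. In the second form, the multiples $k,2k,\dots,(r-2)k$ are absent when $r\le 2$, so that then $P=\{rk\}$. *)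

theory Defs
  imports "Jordan_Normal_Form.Determinant"
begin

(* Indices of 'a mat start at 0; only differences of indices matter below. *)
definition index_dist :: "nat \<Rightarrow> nat \<Rightarrow> nat" where
  "index_dist i j = nat \<bar>int i - int j\<bar>"

definition symmetric_mat :: "real mat \<Rightarrow> bool" where
  "symmetric_mat A \<longleftrightarrow> square_mat A \<and> transpose_mat A = A"

(* The Toeplitz condition in terms of |i - j| already forces symmetry. *)
definition toeplitz_mat :: "real mat \<Rightarrow> bool" where
  "toeplitz_mat A \<longleftrightarrow> square_mat A \<and>
     (\<exists>t. \<forall>i < dim_row A. \<forall>j < dim_row A. A $$ (i, j) = t (index_dist i j))"

definition positive_definite_mat :: "real mat \<Rightarrow> bool" where
  "positive_definite_mat A \<longleftrightarrow> symmetric_mat A \<and>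
     (\<forall>v \<in> carrier_vec (dim_row A). v \<noteq> 0\<^sub>v (dim_row A) \<longrightarrow> v \<bullet> (A *\<^sub>v v) > 0)"

(* Partial matrices have entries in real option; None marks an unspecified entry. *)

(* Values of t outside P and 0 play no role. *)
definition partial_toeplitz_mat :: "nat \<Rightarrow> nat set \<Rightarrow> (nat \<Rightarrow> real) \<Rightarrow> real option mat" where
  "partial_toeplitz_mat n P t = mat n n (\<lambda>(i, j).
     if index_dist i j \<in> insert 0 P then Some (t (index_dist i j)) else None)"

definition is_completion :: "real option mat \<Rightarrow> real mat \<Rightarrow> bool" where
  "is_completion T A \<longleftrightarrow> A \<in> carrier_mat (dim_row T) (dim_col T) \<and> symmetric_mat A \<and>
     (\<forall>i < dim_row T. \<forall>j < dim_col T. \<forall>x. T $$ (i, j) = Some x \<longrightarrow> A $$ (i, j) = x)"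

definition is_pd_completion :: "real option mat \<Rightarrow> real mat \<Rightarrow> bool" where
  "is_pd_completion T A \<longleftrightarrow> is_completion T A \<and> positive_definite_mat A"

definition pd_completable :: "real option mat \<Rightarrow> bool" where
  "pd_completable T \<longleftrightarrow> (\<exists>A. is_pd_completion T A)"

(* A positive definite completable T with specified diagonal has exactly one such A: the
   positive semidefinite completions form a compact convex set, and log det is strictly
   concave on the positive definite ones. *)
definition max_det_completion :: "real option mat \<Rightarrow> real mat" where
  "max_det_completion T =
     (THE A. is_pd_completion T A \<and> (\<forall>B. is_pd_completion T B \<longrightarrow> det B \<le> det A))"

end

(* Let K be the inverse of the maximum determinant completion A; A is the only positive definite
   completion for which K vanishes at all unspecified positions. Both conditions of the theorem are
   equivalent to
     (S)  for p < q in P, either q - p is in P or p + q = n,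
   and (S) is matched with the three forms by looking at k = Min P.

   (S) suffices: deleting the last or the first row and column of A turns K into a Schur complement,
   and under (S) the two Schur complements have the same fill-in positions. By uniqueness the two
   principal submatrices of A are equal, that is, A is Toeplitz.

   (S) is necessary: if A is Toeplitz and x is the first column of K, comparing the two Schur
   complements at a position with |i - j| = q - p not in P gives x_p x_q = x_(n-p) x_(n-q). For data
   t_0 = 1, t_p = t_q = e and 0 elsewhere on P, one has x_p, x_q = -e + O(e^2), while x_(n-p) or
   x_(n-q) is O(e^2) unless p + q = n. *)

theory Submission
  imports Defs "HOL-Analysis.Function_Topology"
begin

section \<open>Positive definite matrices\<close>

text \<open>\<open>max_det_completion\<close> is a definite description, so existence and uniqueness
  of the maximizer are owed before anything can be said about it. Positive definiteness is an open
  condition; the maximum is therefore taken over the compact set of semidefinite completions, and a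
  positive determinant excludes singular ones. From then on only the zero pattern of the inverse is
  used, and uniqueness for a given pattern is a trace argument that applies equally to submatrices
  and reversals of \<open>A\<close>. In the other direction the entries of \<open>A\<close> at
  unspecified positions are unknown, and nothing says in advance that they are small. The expansion
  of \<open>x\<close> in \<open>e\<close> rests on an a priori bound extracted from
  \<open>tr (A K) = n\<close>, first of order \<open>sqrt e\<close>, then of order \<open>e\<close>.
  The exception \<open>p + q = n\<close> is the case in which the relation between the four entries
  of \<open>x\<close> becomes trivial, because \<open>n - p = q\<close> and
  \<open>n - q = p\<close>.\<close>

lemma index_mult_mat_sum:
  assumes "A \<in> carrier_mat n m" "B \<in> carrier_mat m k" "i < n" "j < k"
  shows "(A * B) $$ (i, j) = (\<Sum>l<m. A $$ (i, l) * B $$ (l, j))"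
  using assms by (auto simp: scalar_prod_def atLeast0LessThan intro!: sum.cong)

lemma quadratic_form_eq_sum:
  assumes "A \<in> carrier_mat n n" "v \<in> carrier_vec n"
  shows "v \<bullet> (A *\<^sub>v v) = (\<Sum>i<n. \<Sum>j<n. v $ i * A $$ (i, j) * v $ j)"
  using assms
  by (auto simp: scalar_prod_def atLeast0LessThan sum_distrib_left mult.assoc intro!: sum.cong)

lemma symmetric_mat_iff:
  assumes "A \<in> carrier_mat n n"
  shows "symmetric_mat A \<longleftrightarrow> (\<forall>i<n. \<forall>j<n. A $$ (i, j) = A $$ (j, i))"
proof
  assume s: "symmetric_mat A"
  show "\<forall>i<n. \<forall>j<n. A $$ (i, j) = A $$ (j, i)"
  proof (intro allI impI)
    fix i j assume "i < n" "j < n"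
    then have "A\<^sup>T $$ (i, j) = A $$ (j, i)" using assms by simp
    then show "A $$ (i, j) = A $$ (j, i)" using s by (simp add: symmetric_mat_def)
  qed
next
  assume "\<forall>i<n. \<forall>j<n. A $$ (i, j) = A $$ (j, i)"
  then show "symmetric_mat A" using assms by (auto simp: symmetric_mat_def intro!: eq_matI)
qed

text \<open>Test vectors become plain functions on indices, so that shifting, restricting and
  reindexing them are operations on sums without dimension side conditions.\<close>

lemma positive_definite_mat_iff:
  assumes A: "A \<in> carrier_mat n n"
  shows "positive_definite_mat A \<longleftrightarrow>
    (\<forall>i<n. \<forall>j<n. A $$ (i, j) = A $$ (j, i)) \<and>
    (\<forall>v. (\<exists>i<n. v i \<noteq> 0) \<longrightarrow> 0 < (\<Sum>i<n. \<Sum>j<n. v i * A $$ (i, j) * v j))"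
    (is "_ \<longleftrightarrow> _ \<and> ?Q")
proof -
  have "(\<forall>v\<in>carrier_vec n. v \<noteq> 0\<^sub>v n \<longrightarrow> v \<bullet> (A *\<^sub>v v) > 0) \<longleftrightarrow> ?Q"
  proof
    assume L: "\<forall>v\<in>carrier_vec n. v \<noteq> 0\<^sub>v n \<longrightarrow> v \<bullet> (A *\<^sub>v v) > 0"
    show ?Q
    proof (intro allI impI)
      fix v :: "nat \<Rightarrow> real" assume "\<exists>i<n. v i \<noteq> 0"
      then have "vec n v \<noteq> 0\<^sub>v n" by (metis index_vec index_zero_vec(1))
      then have "vec n v \<bullet> (A *\<^sub>v vec n v) > 0" using L by simp
      then show "0 < (\<Sum>i<n. \<Sum>j<n. v i * A $$ (i, j) * v j)"
        by (simp add: quadratic_form_eq_sum[OF A])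
    qed
  next
    assume R: ?Q
    show "\<forall>v\<in>carrier_vec n. v \<noteq> 0\<^sub>v n \<longrightarrow> v \<bullet> (A *\<^sub>v v) > 0"
    proof (intro ballI impI)
      fix v :: "real vec" assume v: "v \<in> carrier_vec n" "v \<noteq> 0\<^sub>v n"
      then have "\<exists>i<n. v $ i \<noteq> 0" by (metis carrier_vecD eq_vecI index_zero_vec)
      then show "v \<bullet> (A *\<^sub>v v) > 0"
        using R[rule_format, of "($) v"] by (simp add: quadratic_form_eq_sum[OF A v(1)])
    qed
  qed
  then show ?thesis using assms symmetric_mat_iff[OF A] by (auto simp: positive_definite_mat_def)
qed

section \<open>Cholesky factorization, inverses and uniqueness\<close>

text \<open>Eliminating index 0 leaves the Schur complement \<open>b\<close>, again symmetric and
  positive definite, so induction applies. With functions in place of matrices the smaller problem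
  is a mere index shift, without block matrices.\<close>

lemma cholesky_fun:
  fixes a :: "nat \<Rightarrow> nat \<Rightarrow> real"
  assumes "\<forall>i<n. \<forall>j<n. a i j = a j i"
    and "\<forall>v. (\<exists>i<n. v i \<noteq> 0) \<longrightarrow> 0 < (\<Sum>i<n. \<Sum>j<n. v i * a i j * v j)"
  shows "\<exists>g. (\<forall>i<n. g i i > 0) \<and> (\<forall>i<n. \<forall>j<n. i < j \<longrightarrow> g i j = 0) \<and>
    (\<forall>i<n. \<forall>j<n. a i j = (\<Sum>l<n. g i l * g j l))"
  using assms
proof (induction n arbitrary: a)
  case 0
  then show ?case by simp
next
  case (Suc n)
  have sym: "a i j = a j i" if "i < Suc n" "j < Suc n" for i j using Suc.prems(1) that by blast
  have pos: "a 0 0 > 0"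
    using Suc.prems(2)[rule_format, of "\<lambda>i. if i = 0 then 1 else 0"]
    by (auto simp: sum.lessThan_Suc_shift simp del: sum.lessThan_Suc)
  define b where "b i j = a (Suc i) (Suc j) - a (Suc i) 0 * a 0 (Suc j) / a 0 0" for i j
  have "\<exists>g. (\<forall>i<n. g i i > 0) \<and> (\<forall>i<n. \<forall>j<n. i < j \<longrightarrow> g i j = 0) \<and>
    (\<forall>i<n. \<forall>j<n. b i j = (\<Sum>l<n. g i l * g j l))"
  proof (rule Suc.IH)
    show "\<forall>i<n. \<forall>j<n. b i j = b j i"
      using sym by (auto simp: b_def)
    show "\<forall>v. (\<exists>i<n. v i \<noteq> 0) \<longrightarrow> 0 < (\<Sum>i<n. \<Sum>j<n. v i * b i j * v j)"
    proof (intro allI impI)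
      fix v :: "nat \<Rightarrow> real" assume v: "\<exists>i<n. v i \<noteq> 0"
      define s where "s = (\<Sum>j<n. a 0 (Suc j) * v j)"
      have s': "s = (\<Sum>j<n. v j * a (Suc j) 0)"
        unfolding s_def using sym by (intro sum.cong) auto
      \<comment> \<open>The new first coordinate minimizes the quadratic form for fixed
        \<open>v\<close>; completing the square leaves exactly the form of \<open>b\<close>.\<close>
      define u where "u = case_nat (- s / a 0 0) v"
      have u: "u 0 = - s / a 0 0" "u (Suc i) = v i" for i by (simp_all add: u_def)
      have "0 < (\<Sum>i<Suc n. \<Sum>j<Suc n. u i * a i j * u j)"
        using v u(2) by (intro Suc.prems(2)[rule_format]) (metis Suc_mono)
      also have "\<dots> = u 0 * a 0 0 * u 0 + u 0 * s + s * u 0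
          + (\<Sum>i<n. \<Sum>j<n. v i * a (Suc i) (Suc j) * v j)"
      proof -
        have 1: "(\<Sum>j<n. u 0 * a 0 (Suc j) * v j) = u 0 * s"
          by (simp add: s_def sum_distrib_left mult.assoc)
        have 2: "(\<Sum>i<n. v i * a (Suc i) 0 * u 0) = s * u 0"
          by (simp add: s' sum_distrib_right)
        show ?thesis
          by (simp only: sum.lessThan_Suc_shift u(2) sum.distrib 1 2)
      qed
      also have "\<dots> = (\<Sum>i<n. \<Sum>j<n. v i * a (Suc i) (Suc j) * v j) - s * s / a 0 0"
      proof -
        have "u 0 * a 0 0 * u 0 + u 0 * s + s * u 0 = - (s * s / a 0 0)"
          using pos unfolding u(1) by (simp only: field_simps) (simp add: field_simps)
        then show ?thesis by (simp only: diff_conv_add_uminus add.commute)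
      qed
      also have "s * s / a 0 0 = (\<Sum>i<n. \<Sum>j<n. v i * (a (Suc i) 0 * a 0 (Suc j) / a 0 0) * v j)"
      proof -
        have "s * s / a 0 0 = (\<Sum>j<n. v j * a (Suc j) 0) * (\<Sum>j<n. a 0 (Suc j) * v j) / a 0 0"
          by (simp only: s'[symmetric] s_def[symmetric])
        then show ?thesis by (simp only: sum_product sum_divide_distrib) (intro sum.cong refl, simp)
      qed
      finally show "0 < (\<Sum>i<n. \<Sum>j<n. v i * b i j * v j)"
        by (simp add: b_def left_diff_distrib right_diff_distrib sum_subtractf)
    qed
  qed
  then obtain g where g: "\<And>i. i < n \<Longrightarrow> g i i > 0" "\<And>i j. i < n \<Longrightarrow> j < n \<Longrightarrow> i < j \<Longrightarrow> g i j = 0"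
    "\<And>i j. i < n \<Longrightarrow> j < n \<Longrightarrow> b i j = (\<Sum>l<n. g i l * g j l)" by blast
  \<comment> \<open>First column of the factor: column 0 of \<open>a\<close> scaled by
    \<open>1 / sqrt (a 0 0)\<close>, whose outer product is the part subtracted in \<open>b\<close>;
    below and to the right of it stands the factor \<open>g\<close> of \<open>b\<close>.\<close>
  define h where "h i l = (case l of 0 \<Rightarrow> a i 0 / sqrt (a 0 0)
      | Suc l \<Rightarrow> (case i of 0 \<Rightarrow> 0 | Suc i \<Rightarrow> g i l))" for i l
  have h: "h i 0 = a i 0 / sqrt (a 0 0)" "h 0 (Suc l) = 0" "h (Suc i) (Suc l) = g i l" for i l
    by (simp_all add: h_def)
  show ?case
  proof (intro exI[of _ h] conjI allI impI)
    fix i assume "i < Suc n"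
    then show "h i i > 0" using pos g(1) by (cases i) (auto simp: h)
  next
    fix i j assume "i < Suc n" "j < Suc n" "i < j"
    then show "h i j = 0" using g(2) by (cases i; cases j) (auto simp: h)
  next
    fix i j assume ij: "i < Suc n" "j < Suc n"
    have *: "(\<Sum>l<Suc n. h i l * h j l) = a i 0 * a j 0 / a 0 0 + (\<Sum>l<n. h i (Suc l) * h j (Suc l))"
      using pos by (simp add: sum.lessThan_Suc_shift h(1) del: sum.lessThan_Suc)
    show "a i j = (\<Sum>l<Suc n. h i l * h j l)"
    proof (cases "i = 0 \<or> j = 0")
      case True
      then show ?thesis unfolding * using pos sym[OF ij] by (auto simp: h)
    next
      case False
      then obtain i' j' where e: "i = Suc i'" "j = Suc j'" by (metis not0_implies_Suc)
      then have "b i' j' = (\<Sum>l<n. g i' l * g j' l)" using ij g(3) by auto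
      then show ?thesis unfolding * using sym ij by (simp add: e h b_def)
    qed
  qed
qed

lemma cholesky:
  assumes A: "A \<in> carrier_mat n n" and pd: "positive_definite_mat A"
  shows "\<exists>G \<in> carrier_mat n n. det G > 0 \<and> A = G * G\<^sup>T"
proof -
  obtain g where g: "\<forall>i<n. g i i > 0" "\<forall>i<n. \<forall>j<n. i < j \<longrightarrow> g i j = 0"
    "\<forall>i<n. \<forall>j<n. A $$ (i, j) = (\<Sum>l<n. g i l * g j l)"
  proof -
    note pd' = pd[unfolded positive_definite_mat_iff[OF A]]
    show thesis
      by (rule exE[OF cholesky_fun[of n "\<lambda>i j. A $$ (i, j)", OF conjunct1[OF pd'] conjunct2[OF pd']]])
        (elim conjE, rule that)
  qed
  define G where "G = mat n n (\<lambda>(i, j). g i j)"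
  have G: "G \<in> carrier_mat n n" by (simp add: G_def)
  have "det G = prod_list (diag_mat G)"
    using g(2) by (intro det_lower_triangular[OF _ G]) (auto simp: G_def)
  also have "\<dots> > 0"
    unfolding prod_list_diag_prod using g(1) by (intro prod_pos) (simp add: G_def)
  finally have d: "det G > 0" .
  have "A = G * G\<^sup>T"
  proof (rule eq_matI)
    fix i j assume "i < dim_row (G * G\<^sup>T)" "j < dim_col (G * G\<^sup>T)"
    then have ij: "i < n" "j < n" using G by auto
    show "A $$ (i, j) = (G * G\<^sup>T) $$ (i, j)"
      using g(3) ij by (subst index_mult_mat_sum[of _ n n _ n]) (auto simp: G_def)
  qed (use A G in auto)
  with d G show ?thesis by blast
qed

lemma positive_definite_det_pos:
  assumes A: "A \<in> carrier_mat n n" and pd: "positive_definite_mat A"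
  shows "det A > 0"
proof -
  obtain G where G: "G \<in> carrier_mat n n" "det G > 0" "A = G * G\<^sup>T" using cholesky[OF assms] by blast
  have "det A = det G * det G" unfolding G(3) using G(1) by (subst det_mult[of _ n]) (auto simp: det_transpose)
  then show ?thesis using G(2) by simp
qed

text \<open>The inverse is the scaled adjugate. The cofactor formula is kept because cofactors are
  the derivatives of the determinant, which optimality forces to vanish.\<close>

lemma inverse_mat_exists:
  fixes A :: "real mat"
  assumes A: "A \<in> carrier_mat n n" and d: "det A \<noteq> 0"
  shows "\<exists>K \<in> carrier_mat n n. A * K = 1\<^sub>m n \<and> K * A = 1\<^sub>m n \<and>
    (\<forall>i<n. \<forall>j<n. K $$ (i, j) = cofactor A j i / det A)"
proof (intro bexI conjI)
  let ?K = "(1 / det A) \<cdot>\<^sub>m adj_mat A"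
  note adj = adj_mat[OF A]
  show "?K \<in> carrier_mat n n" using adj by simp
  show "A * ?K = 1\<^sub>m n" using adj A d by (simp add: mult_smult_distrib[of A n n _ n]) (auto intro!: eq_matI)
  show "?K * A = 1\<^sub>m n" using adj A d by (simp add: mult_smult_assoc_mat[of _ n n]) (auto intro!: eq_matI)
  show "\<forall>i<n. \<forall>j<n. ?K $$ (i, j) = cofactor A j i / det A" using A by (simp add: adj_mat_def)
qed

lemma inverse_symmetric:
  fixes A :: "real mat"
  assumes A: "A \<in> carrier_mat n n" and K: "K \<in> carrier_mat n n" and "A * K = 1\<^sub>m n" "A\<^sup>T = A"
  shows "K\<^sup>T = K"
proof -
  have KA: "K * A = 1\<^sub>m n" using mat_mult_left_right_inverse assms by blast
  have "K\<^sup>T * A = (A * K)\<^sup>T" using assms by (subst transpose_mult[OF A K]) simp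
  then have "K\<^sup>T * A = 1\<^sub>m n" using assms by simp
  then have "K\<^sup>T * (A * K) = K" using A K by (subst assoc_mult_mat[symmetric, of _ n n _ n]) auto
  then show ?thesis using assms by simp
qed

lemma positive_definite_transpose: "positive_definite_mat A \<Longrightarrow> A\<^sup>T = A"
  by (simp add: positive_definite_mat_def symmetric_mat_def)

text \<open>With \<open>u = K w\<close> one has \<open>A u = w\<close>, so the form of
  \<open>K\<close> at \<open>w\<close> is the form of \<open>A\<close> at \<open>u\<close>.\<close>

lemma positive_definite_inverse:
  assumes A: "A \<in> carrier_mat n n" "positive_definite_mat A"
    and K: "K \<in> carrier_mat n n" "A * K = 1\<^sub>m n"
  shows "positive_definite_mat K"
  unfolding positive_definite_mat_def
proof (intro conjI ballI impI)
  show "symmetric_mat K"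
    using inverse_symmetric[OF A(1) K positive_definite_transpose[OF A(2)]] K(1)
    by (simp add: symmetric_mat_def)
  fix w :: "real vec" assume "w \<in> carrier_vec (dim_row K)" and w0: "w \<noteq> 0\<^sub>v (dim_row K)"
  then have w: "w \<in> carrier_vec n" using K(1) by simp
  let ?u = "K *\<^sub>v w"
  have u: "?u \<in> carrier_vec n" using K(1) w by simp
  have Au: "A *\<^sub>v ?u = w" using A(1) K w by (simp add: assoc_mult_mat_vec[symmetric])
  have "?u \<noteq> 0\<^sub>v n"
  proof
    assume "?u = 0\<^sub>v n"
    then have "w = 0\<^sub>v n" using Au A(1) by (auto intro!: eq_vecI)
    then show False using w0 K(1) by simp
  qed
  then have "?u \<bullet> (A *\<^sub>v ?u) > 0" using A u by (simp add: positive_definite_mat_def)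
  then show "w \<bullet> (K *\<^sub>v w) > 0"
    unfolding Au using comm_scalar_prod[OF u w] by simp
qed

text \<open>With \<open>D = A - B\<close>, the hypothesis says that \<open>D\<close> and \<open>L - K = K D L\<close> have disjoint supports,
  so \<open>tr (K D L D) = 0\<close>; both \<open>K\<close> and \<open>L\<close> being positive definite, this forces \<open>D = 0\<close>.\<close>

lemma positive_definite_eqI:
  assumes A: "A \<in> carrier_mat n n" "positive_definite_mat A"
    and B: "B \<in> carrier_mat n n" "positive_definite_mat B"
    and K: "K \<in> carrier_mat n n" "A * K = 1\<^sub>m n"
    and L: "L \<in> carrier_mat n n" "B * L = 1\<^sub>m n"
    and supp: "\<And>i j. i < n \<Longrightarrow> j < n \<Longrightarrow>
      A $$ (i, j) = B $$ (i, j) \<or> K $$ (i, j) = 0 \<and> L $$ (i, j) = 0"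
  shows "A = B"
proof -
  define D where "D = A - B"
  have D: "D \<in> carrier_mat n n" using A(1) B(1) by (simp add: D_def minus_carrier_mat)
  have DT: "D\<^sup>T = D"
    unfolding D_def using positive_definite_transpose A B by (simp add: transpose_minus)
  obtain H where H: "H \<in> carrier_mat n n" "det H > 0" "L = H * H\<^sup>T"
    using cholesky[OF L(1) positive_definite_inverse[OF B L]] by blast
  \<comment> \<open>As \<open>L = H H^T\<close> and \<open>D\<close> is symmetric,
    \<open>D L D = W W^T\<close>; hence \<open>tr (K D L D)\<close> is a sum of values of the form
    of \<open>K\<close>, one for each column of \<open>W\<close>.\<close>
  define W where "W = D * H"
  have W: "W \<in> carrier_mat n n" unfolding W_def using D H by simp
  have KA: "K * A = 1\<^sub>m n" using mat_mult_left_right_inverse[OF A(1) K] .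
  have "K * D * L = (K * A - K * B) * L"
    unfolding D_def using A B K by (simp add: mult_minus_distrib_mat[of K n n])
  also have "\<dots> = (1\<^sub>m n) * L - K * (B * L)"
    using A B K L KA by (simp add: minus_mult_distrib_mat[of _ n n] assoc_mult_mat[of K n n B n L])
  finally have KDL: "K * D * L = L - K" using L K by simp
  have WW: "W * W\<^sup>T = D * L * D"
  proof -
    have "W * W\<^sup>T = D * H * (H\<^sup>T * D)"
      unfolding W_def using D H DT by (simp add: transpose_mult[of D n n H n])
    also have "\<dots> = D * (H * (H\<^sup>T * D))" using D H by (intro assoc_mult_mat[of _ n n _ n]) auto
    also have "H * (H\<^sup>T * D) = H * H\<^sup>T * D" using D H by (intro assoc_mult_mat[symmetric, of _ n n _ n]) auto
    also have "D * (H * H\<^sup>T * D) = D * L * D"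
      unfolding H(3) using D H by (intro assoc_mult_mat[symmetric, of _ n n _ n]) auto
    finally show ?thesis .
  qed
  have KWW: "K * (W * W\<^sup>T) = (L - K) * D"
  proof -
    have "K * (D * L * D) = K * (D * L) * D" using K D L by (intro assoc_mult_mat[symmetric, of _ n n _ n]) auto
    also have "K * (D * L) = K * D * L" using K D L by (intro assoc_mult_mat[symmetric, of _ n n _ n]) auto
    finally show ?thesis unfolding WW KDL .
  qed
  note pdK = positive_definite_inverse[OF A K, unfolded positive_definite_mat_iff[OF K(1)]]
  \<comment> \<open>The form of \<open>K\<close> at column \<open>c\<close> of \<open>W\<close>.
    These numbers are nonnegative and sum to the trace, so a zero trace makes each of them, and then
    each column, vanish.\<close>
  define q where "q c = (\<Sum>i<n. \<Sum>l<n. W $$ (i, c) * K $$ (i, l) * W $$ (l, c))" for c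
  have q_pos: "q c > 0" if "\<exists>i<n. W $$ (i, c) \<noteq> 0" for c
    unfolding q_def using conjunct2[OF pdK, rule_format, of "\<lambda>i. W $$ (i, c)"] that by blast
  have q_nonneg: "q c \<ge> 0" for c
  proof (cases "\<exists>i<n. W $$ (i, c) \<noteq> 0")
    case True
    then show ?thesis using q_pos[of c] by simp
  next
    case False
    then show ?thesis by (simp add: q_def)
  qed
  have "(\<Sum>c<n. q c) = (\<Sum>i<n. \<Sum>l<n. \<Sum>c<n. W $$ (i, c) * K $$ (i, l) * W $$ (l, c))"
    unfolding q_def by (subst sum.swap, rule sum.cong[OF refl], subst sum.swap) simp
  also have "\<dots> = (\<Sum>i<n. \<Sum>l<n. K $$ (i, l) * (\<Sum>c<n. W $$ (l, c) * W $$ (i, c)))"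
    by (simp add: sum_distrib_left mult_ac)
  also have "\<dots> = (\<Sum>i<n. \<Sum>l<n. K $$ (i, l) * (W * W\<^sup>T) $$ (l, i))"
    using W by (intro sum.cong refl) (subst index_mult_mat_sum[of _ n n _ n], auto)
  also have "\<dots> = (\<Sum>i<n. (K * (W * W\<^sup>T)) $$ (i, i))"
    using W K by (intro sum.cong refl) (subst (2) index_mult_mat_sum[of _ n n _ n], auto)
  also have "\<dots> = (\<Sum>i<n. \<Sum>j<n. (L - K) $$ (i, j) * D $$ (j, i))"
    unfolding KWW using L K D by (intro sum.cong refl) (subst index_mult_mat_sum[of _ n n _ n], auto)
  also have "\<dots> = 0"
  proof (intro sum.neutral ballI)
    fix i j assume "i \<in> {..<n}" "j \<in> {..<n}"
    then have ij: "i < n" "j < n" by auto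
    have "D $$ (j, i) = D\<^sup>T $$ (i, j)" using ij D by simp
    then have "D $$ (j, i) = A $$ (i, j) - B $$ (i, j)" unfolding DT using ij A B by (simp add: D_def)
    then show "(L - K) $$ (i, j) * D $$ (j, i) = 0" using supp[OF ij] ij L K by auto
  qed
  finally have "\<forall>c\<in>{..<n}. q c = 0" using q_nonneg by (subst (asm) sum_nonneg_eq_0_iff) auto
  then have W0: "W $$ (i, c) = 0" if "i < n" "c < n" for i c using that q_pos[of c] by force
  \<comment> \<open>\<open>H\<close> is invertible, so \<open>W = D H = 0\<close> gives
    \<open>D = 0\<close>.\<close>
  obtain J where J: "J \<in> carrier_mat n n" "H * J = 1\<^sub>m n" using inverse_mat_exists[OF H(1)] H(2) by auto
  have "D = W * J" unfolding W_def using D H J by simp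
  also have "\<dots> = 0\<^sub>m n n"
  proof (rule eq_matI)
    fix i j assume "i < dim_row (0\<^sub>m n n)" "j < dim_col (0\<^sub>m n n :: real mat)"
    then show "(W * J) $$ (i, j) = 0\<^sub>m n n $$ (i, j)"
      using W J W0 by (subst index_mult_mat_sum[of _ n n _ n]) auto
  qed (use W J in auto)
  finally have D0: "D = 0\<^sub>m n n" .
  show ?thesis
  proof (rule eq_matI)
    fix i j assume "i < dim_row B" "j < dim_col B"
    then have "i < n" "j < n" using B by auto
    moreover from this have "D $$ (i, j) = 0" unfolding D0 by simp
    ultimately show "A $$ (i, j) = B $$ (i, j)" using A B by (simp add: D_def)
  qed (use A B in auto)
qed

section \<open>Inequalities for quadratic forms\<close>

text \<open>A quadratic polynomial in \<open>c\<close>, from which inequalities are read off by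
  choosing \<open>c\<close>. The direction \<open>w\<close> will be a column of the inverse, the
  vector \<open>A v\<close>, or a unit vector.\<close>

lemma quadratic_form_diff:
  fixes A :: "real mat"
  assumes A: "A \<in> carrier_mat n n" "A\<^sup>T = A" and v: "v \<in> carrier_vec n" and w: "w \<in> carrier_vec n"
  shows "(v - c \<cdot>\<^sub>v w) \<bullet> (A *\<^sub>v (v - c \<cdot>\<^sub>v w)) =
    v \<bullet> (A *\<^sub>v v) - 2 * c * (v \<bullet> (A *\<^sub>v w)) + c\<^sup>2 * (w \<bullet> (A *\<^sub>v w))"
proof -
  have sym: "w \<bullet> (A *\<^sub>v v) = v \<bullet> (A *\<^sub>v w)"
    using transpose_vec_mult_scalar[of A n n v w] A v w comm_scalar_prod[of w n "A *\<^sub>v v"]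
      comm_scalar_prod[of v n "A *\<^sub>v w"] by simp
  have Aw: "A *\<^sub>v w \<in> carrier_vec n" "A *\<^sub>v v \<in> carrier_vec n" using A v w by auto
  have "A *\<^sub>v (v - c \<cdot>\<^sub>v w) = A *\<^sub>v v - c \<cdot>\<^sub>v (A *\<^sub>v w)"
    using A v w by (simp add: mult_minus_distrib_mat_vec[of A n n] mult_mat_vec)
  then show ?thesis
    using v w Aw
    by (simp add: minus_scalar_prod_distrib[of _ n] scalar_prod_minus_distrib[of _ n] sym
        power2_eq_square algebra_simps)
qed

text \<open>Cauchy-Schwarz for the inner product given by \<open>A\<close>: \<open>v i\<close> is
  the product of \<open>v\<close> with column \<open>i\<close> of \<open>K\<close>, and that column
  has squared length \<open>K $$ (i, i)\<close>.\<close>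

lemma positive_definite_cauchy:
  assumes A: "A \<in> carrier_mat n n" "positive_definite_mat A"
    and K: "K \<in> carrier_mat n n" "A * K = 1\<^sub>m n" and i: "i < n"
  shows "(v i)\<^sup>2 \<le> K $$ (i, i) * (\<Sum>p<n. \<Sum>q<n. v p * A $$ (p, q) * v q)"
proof -
  note [simp] = positive_definite_transpose[OF A(2)]
  let ?x = "vec n v" and ?k = "col K i"
  have k: "?k \<in> carrier_vec n" using K i by auto
  have Ak: "A *\<^sub>v ?k = unit_vec n i"
  proof -
    have "col (A * K) i = A *\<^sub>v ?k" using A K i by (intro col_mult2[of _ n n _ n]) auto
    then show ?thesis unfolding K(2) using i by simp
  qed
  have kk: "K $$ (i, i) > 0"
  proof -
    have "(\<Sum>p<n. \<Sum>q<n. (if p = i then 1 else 0) * K $$ (p, q) * (if q = i then 1 else 0)) = K $$ (i, i)"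
      using i by (simp add: if_distrib[of "\<lambda>x. x * _"] if_distrib[of "\<lambda>x. _ * x"] cong: if_cong)
    then show ?thesis
      using positive_definite_inverse[OF A K, unfolded positive_definite_mat_iff[OF K(1)], THEN conjunct2,
          rule_format, of "\<lambda>p. if p = i then 1 else 0"] i by auto
  qed
  \<comment> \<open>The coefficient of the \<open>A\<close>-orthogonal projection of the vector onto
    column \<open>i\<close> of \<open>K\<close>.\<close>
  define c where "c = v i / K $$ (i, i)"
  have nonneg: "u \<bullet> (A *\<^sub>v u) \<ge> 0" if "u \<in> carrier_vec n" for u
  proof (cases "u = 0\<^sub>v n")
    case True
    then show ?thesis using A by simp
  next
    case False
    then show ?thesis using A that unfolding positive_definite_mat_def by (metis carrier_matD(1) less_imp_le)
  qed
  have "0 \<le> (?x - c \<cdot>\<^sub>v ?k) \<bullet> (A *\<^sub>v (?x - c \<cdot>\<^sub>v ?k))" using k by (intro nonneg) auto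
  also have "\<dots> = ?x \<bullet> (A *\<^sub>v ?x) - 2 * c * v i + c\<^sup>2 * K $$ (i, i)"
    using quadratic_form_diff[OF A(1) _ _ k, of ?x c] k i K by (simp add: Ak)
  also have "\<dots> = ?x \<bullet> (A *\<^sub>v ?x) - (v i)\<^sup>2 / K $$ (i, i)"
    using kk by (simp add: c_def power2_eq_square)
  finally have "(v i)\<^sup>2 \<le> K $$ (i, i) * (?x \<bullet> (A *\<^sub>v ?x))" using kk by (simp add: field_simps)
  then show ?thesis by (simp add: quadratic_form_eq_sum[OF A(1)])
qed

text \<open>If a semidefinite form vanishes at \<open>v\<close>, moving from \<open>v\<close>
  slightly against \<open>A v\<close> would make it negative unless \<open>A v = 0\<close>, which a
  nonzero determinant excludes. This upgrades the maximizer found among semidefinite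
  completions.\<close>

lemma positive_semidefinite_det_nonzero:
  fixes A :: "real mat"
  assumes A: "A \<in> carrier_mat n n" "A\<^sup>T = A"
    and psd: "\<And>v. v \<in> carrier_vec n \<Longrightarrow> v \<bullet> (A *\<^sub>v v) \<ge> 0" and d: "det A \<noteq> 0"
  shows "positive_definite_mat A"
proof -
  have "v \<bullet> (A *\<^sub>v v) > 0" if v: "v \<in> carrier_vec n" and v0: "v \<noteq> 0\<^sub>v n" for v
  proof (rule ccontr)
    assume "\<not> v \<bullet> (A *\<^sub>v v) > 0"
    then have q0: "v \<bullet> (A *\<^sub>v v) = 0" using psd[OF v] by simp
    let ?u = "A *\<^sub>v v"
    have u: "?u \<in> carrier_vec n" using A v by simp
    have vu: "v \<bullet> (A *\<^sub>v ?u) = ?u \<bullet> ?u"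
      using transpose_vec_mult_scalar[of A n n ?u v] A v u by simp
    have ineq: "2 * c * (?u \<bullet> ?u) \<le> c\<^sup>2 * (?u \<bullet> (A *\<^sub>v ?u))" for c
    proof -
      have "0 \<le> (v - c \<cdot>\<^sub>v ?u) \<bullet> (A *\<^sub>v (v - c \<cdot>\<^sub>v ?u))" using v u by (intro psd) auto
      then show ?thesis unfolding quadratic_form_diff[OF A v u] q0 vu by simp
    qed
    have "?u \<bullet> ?u > 0"
    proof -
      have "?u \<noteq> 0\<^sub>v n" using v v0 d det_0_iff_vec_prod_zero_field[OF A(1)] by blast
      then obtain i where i: "i < n" "?u $ i \<noteq> 0" using u by (metis carrier_vecD eq_vecI index_zero_vec)
      have "?u \<bullet> ?u = (\<Sum>i<n. (?u $ i)\<^sup>2)"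
        using u A by (simp add: scalar_prod_def atLeast0LessThan power2_eq_square del: index_mult_mat_vec)
      also have "\<dots> > 0" using i by (intro sum_pos2[of _ i]) auto
      finally show ?thesis .
    qed
    moreover define r where "r = ?u \<bullet> (A *\<^sub>v ?u)"
    moreover define s where "s = ?u \<bullet> ?u"
    ultimately have s: "s > 0" and r: "\<And>c. 2 * c * s \<le> c\<^sup>2 * r" using ineq by auto
    have "r \<noteq> 0" using r[of 1] s by auto
    moreover have "r \<ge> 0" using psd[OF u] by (simp add: r_def)
    ultimately have "r > 0" by simp
    \<comment> \<open>\<open>c = s / r\<close> minimizes \<open>c^2 * r - 2 * c * s\<close>, where
      the value is negative.\<close>
    then have "2 * (s * s) / r \<le> s * s / r" using r[of "s / r"] by (simp add: power2_eq_square)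
    moreover have "s * s / r > 0" using s \<open>r > 0\<close> by simp
    ultimately show False by simp
  qed
  then show ?thesis using A by (simp add: positive_definite_mat_def symmetric_mat_def)
qed

lemma continuous_on_det:
  fixes F :: "'a :: topological_space \<Rightarrow> real mat"
  assumes "\<And>x. F x \<in> carrier_mat n n"
    and "\<And>i j. i < n \<Longrightarrow> j < n \<Longrightarrow> continuous_on S (\<lambda>x. F x $$ (i, j))"
  shows "continuous_on S (\<lambda>x. det (F x))"
proof -
  have "p i < n" if "p permutes {0..<n}" "i < n" for p i
    using permutes_in_image[OF that(1), of i] that(2) by simp
  then show ?thesis
    unfolding det_def'[OF assms(1)]
    by (intro continuous_intros assms(2)) auto
qed

section \<open>Maximum determinant completions\<close>

text \<open>Evaluation at the sum and the difference of two unit vectors. Since the diagonal is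
  specified, this bounds all entries of all positive definite completions at once.\<close>

lemma positive_definite_entry_bound:
  assumes A: "A \<in> carrier_mat n n" "positive_definite_mat A" and ij: "i < n" "j < n"
  shows "2 * \<bar>A $$ (i, j)\<bar> \<le> A $$ (i, i) + A $$ (j, j)"
proof -
  have psd: "v \<bullet> (A *\<^sub>v v) \<ge> 0" if "v \<in> carrier_vec n" for v
  proof (cases "v = 0\<^sub>v n")
    case True
    then show ?thesis using A by simp
  next
    case False
    then show ?thesis using A that unfolding positive_definite_mat_def by (metis carrier_matD(1) less_imp_le)
  qed
  have e: "unit_vec n k \<bullet> (A *\<^sub>v unit_vec n l) = A $$ (k, l)" if "k < n" "l < n" for k l
    using that A by simp
  have "0 \<le> A $$ (i, i) - 2 * c * A $$ (i, j) + c\<^sup>2 * A $$ (j, j)" for c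
    using psd[of "unit_vec n i - c \<cdot>\<^sub>v unit_vec n j"]
      quadratic_form_diff[OF A(1) positive_definite_transpose[OF A(2)], of "unit_vec n i" "unit_vec n j" c]
      e ij by simp
  from this[of 1] this[of "- 1"] show ?thesis by (simp add: abs_if)
qed

lemma continuous_on_eval_fun: "continuous_on S (\<lambda>f :: 'a \<Rightarrow> 'b :: topological_space. f x)"
  by (rule continuous_on_subset[OF continuous_on_product_coordinates]) simp

lemma closed_eval_fun_eq:
  "closed {f :: 'a \<Rightarrow> real. f x = f y}" "closed {f :: 'a \<Rightarrow> real. f x = c}"
  by (intro closed_Collect_eq continuous_intros continuous_on_eval_fun)+

text \<open>Matrices are represented by functions on index pairs, so that Tychonoff's theorem applies.\<close>

lemma max_det_pd_completion_exists:
  assumes T: "T \<in> carrier_mat n n" and diag: "\<And>i. i < n \<Longrightarrow> T $$ (i, i) \<noteq> None"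
    and pdc: "pd_completable T"
  shows "\<exists>A. is_pd_completion T A \<and> (\<forall>B. is_pd_completion T B \<longrightarrow> det B \<le> det A)"
proof -
  obtain A0 where A0: "is_pd_completion T A0" using pdc by (auto simp: pd_completable_def)
  \<comment> \<open>All completions share the diagonal of \<open>A0\<close>, so \<open>C\<close>
    dominates their diagonal entries and therefore all their entries.\<close>
  define C where "C = (\<Sum>i<n. \<bar>A0 $$ (i, i)\<bar>)"
  have C: "C \<ge> 0" by (simp add: C_def sum_nonneg)
  define M where "M f = mat n n f" for f :: "nat \<times> nat \<Rightarrow> real"
  have M: "M f \<in> carrier_mat n n" for f by (simp add: M_def)
  define S1 where "S1 = PiE UNIV (\<lambda>_ :: nat \<times> nat. {- C..C})"
  define S2 where "S2 = (\<Inter>i\<in>{..<n}. \<Inter>j\<in>{..<n}. {f :: nat \<times> nat \<Rightarrow> real. f (i, j) = f (j, i)})"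
  define S3 where "S3 = (\<Inter>i\<in>{..<n}. \<Inter>j\<in>{..<n}. \<Inter>x\<in>{x. T $$ (i, j) = Some x}.
    {f :: nat \<times> nat \<Rightarrow> real. f (i, j) = x})"
  \<comment> \<open>Semidefiniteness rather than definiteness, because only weak inequalities define
    a closed set.\<close>
  define S4 where "S4 = (\<Inter>v. {f :: nat \<times> nat \<Rightarrow> real. 0 \<le> (\<Sum>i<n. \<Sum>j<n. v i * f (i, j) * v j)})"
  define S where "S = S1 \<inter> S2 \<inter> S3 \<inter> S4"
  have "compactin (product_topology (\<lambda>_. euclidean) UNIV) S1"
    unfolding S1_def by (subst compactin_PiE) simp
  then have "compact S1" by (simp add: euclidean_product_topology)
  moreover have "closed S2" unfolding S2_def
    by (intro closed_INT ballI closed_eval_fun_eq)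
  moreover have "closed S3" unfolding S3_def
    by (intro closed_INT ballI closed_eval_fun_eq)
  moreover have "closed S4" unfolding S4_def
    by (intro closed_INT ballI closed_Collect_le continuous_intros continuous_on_eval_fun)
  ultimately have compS: "compact S" unfolding S_def by (intro compact_Int_closed)
  have into_S: "\<exists>f\<in>S. M f = B" if B: "is_pd_completion T B" for B
  proof -
    have Bc: "B \<in> carrier_mat n n" and Bpd: "positive_definite_mat B"
      and BT: "\<And>i j x. i < n \<Longrightarrow> j < n \<Longrightarrow> T $$ (i, j) = Some x \<Longrightarrow> B $$ (i, j) = x"
      using B T by (auto simp: is_pd_completion_def is_completion_def)
    have "B $$ (i, i) = A0 $$ (i, i)" if "i < n" for i
      using diag[OF that] BT[OF that that] A0 T that
      by (auto simp: is_pd_completion_def is_completion_def)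
    then have Bii: "B $$ (i, i) \<le> C" if "i < n" for i
      using that member_le_sum[of i "{..<n}" "\<lambda>i. \<bar>A0 $$ (i, i)\<bar>"] by (force simp: C_def)
    have bound: "\<bar>B $$ (i, j)\<bar> \<le> C" if "i < n" "j < n" for i j
      using positive_definite_entry_bound[OF Bc Bpd that] Bii[OF that(1)] Bii[OF that(2)] by simp
    \<comment> \<open>The value 0 outside the index square lies in the box \<open>S1\<close> because
      \<open>C \<ge> 0\<close>.\<close>
    define f where "f p = (if fst p < n \<and> snd p < n then B $$ p else 0)" for p
    have f: "f (i, j) = B $$ (i, j)" if "i < n" "j < n" for i j using that by (simp add: f_def)
    have "M f = B" using Bc by (auto simp: M_def f intro!: eq_matI)
    moreover have "f \<in> S1" using C bound by (auto simp: S1_def f_def abs_le_iff)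
        (metis bound abs_le_iff minus_le_iff)+
    moreover have "f \<in> S2" "f \<in> S4" unfolding S2_def S4_def
      using Bpd[unfolded positive_definite_mat_iff[OF Bc]]
    proof -
      assume *: "(\<forall>i<n. \<forall>j<n. B $$ (i, j) = B $$ (j, i)) \<and>
        (\<forall>v. (\<exists>i<n. v i \<noteq> 0) \<longrightarrow> 0 < (\<Sum>i<n. \<Sum>j<n. v i * B $$ (i, j) * v j))"
      show "f \<in> (\<Inter>i\<in>{..<n}. \<Inter>j\<in>{..<n}. {f. f (i, j) = f (j, i)})"
        using conjunct1[OF *] by (simp add: f)
      have "0 \<le> (\<Sum>i<n. \<Sum>j<n. v i * B $$ (i, j) * v j)" for v
      proof (cases "\<exists>i<n. v i \<noteq> 0")
        case True
        then show ?thesis using conjunct2[OF *] by (simp add: less_imp_le)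
      qed simp
      then show "f \<in> (\<Inter>v. {f. 0 \<le> (\<Sum>i<n. \<Sum>j<n. v i * f (i, j) * v j)})" by (simp add: f)
    qed
    moreover have "f \<in> S3" using BT by (auto simp: S3_def f)
    ultimately show ?thesis unfolding S_def by blast
  qed
  have "continuous_on S (\<lambda>f. det (M f))"
    by (rule continuous_on_det[OF M]) (simp add: M_def continuous_on_eval_fun)
  moreover have "S \<noteq> {}" using into_S[OF A0] by blast
  ultimately obtain f where f: "f \<in> S" and fmax: "\<And>g. g \<in> S \<Longrightarrow> det (M g) \<le> det (M f)"
    using continuous_attains_sup[OF compS] by blast
  have max: "det B \<le> det (M f)" if "is_pd_completion T B" for B
    using into_S[OF that] fmax by blast
  \<comment> \<open>The maximum is at least \<open>det A0\<close>, so the maximizer is nonsingular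
    and hence positive definite.\<close>
  have "det A0 > 0"
    using A0 T by (intro positive_definite_det_pos[of _ n]) (auto simp: is_pd_completion_def is_completion_def)
  then have dpos: "det (M f) \<noteq> 0" using max[OF A0] by simp
  have sym: "(M f)\<^sup>T = M f" using f by (auto simp: S_def S2_def M_def intro!: eq_matI)
  have "positive_definite_mat (M f)"
  proof (rule positive_semidefinite_det_nonzero[OF M sym _ dpos])
    fix v :: "real vec" assume v: "v \<in> carrier_vec n"
    have "0 \<le> (\<Sum>i<n. \<Sum>j<n. v $ i * f (i, j) * v $ j)" using f unfolding S_def S4_def by blast
    then show "0 \<le> v \<bullet> (M f *\<^sub>v v)" unfolding quadratic_form_eq_sum[OF M v] by (simp add: M_def)
  qed
  moreover have "is_completion T (M f)"
    using f T M[of f] sym by (auto simp: is_completion_def symmetric_mat_def S_def S3_def M_def)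
  ultimately show ?thesis using max by (auto simp: is_pd_completion_def)
qed

section \<open>First-order optimality and uniqueness of the maximizer\<close>

text \<open>The cofactors of row \<open>p\<close> do not involve row \<open>p\<close>, so the
  determinant is affine in each single entry, with the cofactor as slope.\<close>

lemma det_add_entry:
  fixes A :: "'a :: comm_ring_1 mat"
  assumes A: "A \<in> carrier_mat n n" and pq: "p < n" "q < n"
  shows "det (mat n n (\<lambda>(i, j). A $$ (i, j) + (if i = p \<and> j = q then s else 0))) =
    det A + s * cofactor A p q" (is "det ?B = _")
proof -
  have cof: "cofactor ?B p j = cofactor A p j" if "j < n" for j
  proof -
    have "mat_delete ?B p j = mat_delete A p j"
      using A pq that by (auto simp: mat_delete_def intro!: eq_matI)
    then show ?thesis by (simp add: cofactor_def)
  qed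
  have "det ?B = (\<Sum>j<n. ?B $$ (p, j) * cofactor ?B p j)"
    using pq by (intro laplace_expansion_row) auto
  also have "\<dots> = (\<Sum>j<n. A $$ (p, j) * cofactor A p j + (if j = q then s * cofactor A p q else 0))"
    using pq by (intro sum.cong refl) (auto simp: cof algebra_simps)
  also have "\<dots> = det A + s * cofactor A p q"
    using pq by (simp add: sum.distrib laplace_expansion_row[OF A pq(1)])
  finally show ?thesis .
qed

lemma cofactor_transpose:
  assumes "A \<in> carrier_mat n n" "i < n" "j < n"
  shows "cofactor A\<^sup>T i j = cofactor A j i"
proof -
  have "mat_delete A\<^sup>T i j = (mat_delete A j i)\<^sup>T"
    using assms by (auto simp: mat_delete_def intro!: eq_matI)
  moreover have "mat_delete A j i \<in> carrier_mat (n - 1) (n - 1)" using assms by (simp add: mat_delete_def)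
  ultimately show ?thesis by (simp add: cofactor_def det_transpose add.commute)
qed

text \<open>First-order optimality: perturb the entries \<open>(p, q)\<close> and \<open>(q, p)\<close> of a maximizer by \<open>s\<close>.\<close>

lemma max_det_inverse_zero:
  assumes T: "T \<in> carrier_mat n n"
    and A: "is_pd_completion T A" and max: "\<And>B. is_pd_completion T B \<Longrightarrow> det B \<le> det A"
    and K: "K \<in> carrier_mat n n" "A * K = 1\<^sub>m n"
    and pq: "p < n" "q < n" "p \<noteq> q" "T $$ (p, q) = None" "T $$ (q, p) = None"
  shows "K $$ (p, q) = 0"
proof -
  have Ac: "A \<in> carrier_mat n n" and Apd: "positive_definite_mat A"
    and AT: "\<And>i j x. i < n \<Longrightarrow> j < n \<Longrightarrow> T $$ (i, j) = Some x \<Longrightarrow> A $$ (i, j) = x"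
    using A T by (auto simp: is_pd_completion_def is_completion_def)
  note Apd' = Apd[unfolded positive_definite_mat_iff[OF Ac]]
  note sym = conjunct1[OF Apd', rule_format]
  have AT': "A\<^sup>T = A" using positive_definite_transpose[OF Apd] .
  define A1 where "A1 s = mat n n (\<lambda>(i, j). A $$ (i, j) + (if i = p \<and> j = q then s else 0))" for s
  define B where "B s = mat n n (\<lambda>(i, j). A1 s $$ (i, j) + (if i = q \<and> j = p then s else 0))" for s
  have A1: "A1 s \<in> carrier_mat n n" for s by (simp add: A1_def)
  have B: "B s \<in> carrier_mat n n" for s by (simp add: B_def)
  have Bij: "B s $$ (i, j) = A $$ (i, j) + (if i = p \<and> j = q \<or> i = q \<and> j = p then s else 0)"
    if "i < n" "j < n" for i j s using that pq by (auto simp: B_def A1_def)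
  \<comment> \<open>The symmetric perturbation is made in two single-entry steps; the second
    cofactor still depends on \<open>s\<close>, and \<open>g 0\<close> is the derivative of
    \<open>det (B s)\<close> at 0.\<close>
  define g where "g s = cofactor A p q + cofactor (A1 s) q p" for s
  have detB: "det (B s) = det A + s * g s" for s
    using det_add_entry[OF A1 pq(2,1), of s s] det_add_entry[OF Ac pq(1,2), of s]
    by (simp add: B_def A1_def g_def distrib_left)
  \<comment> \<open>By Cauchy-Schwarz, \<open>2 * \<bar>v p * v q\<bar>\<close> is at most
    \<open>(K $$ (p, p) + K $$ (q, q)) * Q v\<close>, so the perturbed form stays positive for
    \<open>\<bar>s\<bar> < 1 / R\<close>. The summand 1 makes \<open>1 / R\<close>
    meaningful.\<close>
  define R where "R = 1 + K $$ (p, p) + K $$ (q, q)"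
  define Q where "Q v = (\<Sum>i<n. \<Sum>j<n. v i * A $$ (i, j) * v j)" for v
  have cs: "(v i)\<^sup>2 \<le> K $$ (i, i) * Q v" if "i < n" for i v
    using positive_definite_cauchy[OF Ac Apd K that, of v] by (simp add: Q_def)
  have Qpos: "Q v > 0" if "\<exists>i<n. v i \<noteq> 0" for v
    using conjunct2[OF Apd'] that by (simp add: Q_def)
  have Kpos: "K $$ (i, i) \<ge> 0" if i: "i < n" for i
  proof -
    define e :: "nat \<Rightarrow> real" where "e j = (if j = i then 1 else 0)" for j
    have "Q e > 0" using i by (intro Qpos) (auto simp: e_def)
    moreover have "0 \<le> K $$ (i, i) * Q e" using cs[OF i, of e] by (meson order_trans zero_le_power2)
    ultimately show ?thesis by (simp add: zero_le_mult_iff)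
  qed
  have R: "R \<ge> 1" using Kpos pq by (simp add: R_def)
  have le0: "s * g s \<le> 0" if s: "\<bar>s\<bar> < 1 / R" for s
  proof -
    have "positive_definite_mat (B s)"
      unfolding positive_definite_mat_iff[OF B]
    proof (intro conjI allI impI)
      fix i j assume "i < n" "j < n"
      then show "B s $$ (i, j) = B s $$ (j, i)" using sym by (auto simp: Bij)
    next
      fix v :: "nat \<Rightarrow> real" assume v: "\<exists>i<n. v i \<noteq> 0"
      have "(\<Sum>i<n. \<Sum>j<n. v i * B s $$ (i, j) * v j) =
        (\<Sum>i<n. \<Sum>j<n. v i * A $$ (i, j) * v j + (if i = p \<and> j = q then s * v p * v q else 0)
          + (if i = q \<and> j = p then s * v p * v q else 0))"
        using pq by (intro sum.cong refl) (auto simp: Bij algebra_simps)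
      also have "\<dots> = Q v + (\<Sum>i<n. \<Sum>j<n. if i = p \<and> j = q then s * v p * v q else 0)
          + (\<Sum>i<n. \<Sum>j<n. if i = q \<and> j = p then s * v p * v q else 0)"
        by (simp add: sum.distrib Q_def)
      also have "\<dots> = Q v + 2 * (s * (v p * v q))"
      proof -
        have "(\<Sum>i<n. \<Sum>j<n. if i = a \<and> j = b then c else 0) = c" if "a < n" "b < n" for a b :: nat and c :: real
        proof -
          have "(\<Sum>j<n. if i = a \<and> j = b then c else 0) = (if i = a then c else 0)" for i
            using that by (cases "i = a") auto
          then show ?thesis using that by simp
        qed
        then show ?thesis using pq by simp
      qed
      finally have *: "(\<Sum>i<n. \<Sum>j<n. v i * B s $$ (i, j) * v j) = Q v + 2 * (s * (v p * v q))" .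
      have "\<bar>2 * (v p * v q)\<bar> \<le> (v p)\<^sup>2 + (v q)\<^sup>2"
        using sum_squares_bound[of "v p" "v q"] sum_squares_bound[of "- v p" "v q"] by (simp add: abs_le_iff)
      also have "\<dots> \<le> K $$ (p, p) * Q v + K $$ (q, q) * Q v" using cs pq by (intro add_mono) auto
      also have "\<dots> \<le> R * Q v" using Qpos[OF v] by (simp add: R_def algebra_simps)
      finally have "\<bar>s\<bar> * \<bar>2 * (v p * v q)\<bar> \<le> \<bar>s\<bar> * (R * Q v)" by (rule mult_left_mono) simp
      also have "\<dots> < Q v"
      proof -
        have "\<bar>s\<bar> * R < 1" using s R by (simp add: field_simps)
        then show ?thesis using Qpos[OF v] by (simp add: mult.assoc[symmetric])
      qed
      finally have "\<bar>2 * (s * (v p * v q))\<bar> < Q v" by (simp add: abs_mult mult_ac)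
      then show "0 < (\<Sum>i<n. \<Sum>j<n. v i * B s $$ (i, j) * v j)" unfolding * by (simp add: abs_less_iff)
    qed
    moreover have "is_completion T (B s)"
      unfolding is_completion_def
    proof (intro conjI allI impI)
      show "B s \<in> carrier_mat (dim_row T) (dim_col T)" using B T by simp
      show "symmetric_mat (B s)" using \<open>positive_definite_mat (B s)\<close> by (simp add: positive_definite_mat_def)
      fix i j x assume "i < dim_row T" "j < dim_col T" "T $$ (i, j) = Some x"
      then show "B s $$ (i, j) = x" using T pq AT by (auto simp: Bij)
    qed
    ultimately have "det (B s) \<le> det A" by (intro max) (simp add: is_pd_completion_def)
    then show ?thesis by (simp add: detB)
  qed
  have "continuous_on UNIV g"
  proof -
    have "continuous_on UNIV (\<lambda>s. det (mat_delete (A1 s) q p))"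
    proof (rule continuous_on_det)
      show "mat_delete (A1 s) q p \<in> carrier_mat (n - 1) (n - 1)" for s using A1[of s] by (simp add: mat_delete_def)
      fix i j assume ij: "i < n - 1" "j < n - 1"
      then have eq: "(\<lambda>s. mat_delete (A1 s) q p $$ (i, j)) =
        (\<lambda>s. A $$ (insert_index q i, insert_index p j) + (if insert_index q i = p \<and> insert_index p j = q then s else 0))"
        by (auto simp: mat_delete_def A1_def insert_index_def)
      show "continuous_on UNIV (\<lambda>s. mat_delete (A1 s) q p $$ (i, j))"
        unfolding eq by (cases "insert_index q i = p \<and> insert_index p j = q") (auto intro!: continuous_intros)
    qed
    then show ?thesis unfolding g_def cofactor_def by (intro continuous_intros)
  qed
  then have "(g \<longlongrightarrow> g 0) (at 0)" by (simp add: continuous_on_eq_continuous_at continuous_at)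
  then have lim: "(g \<longlongrightarrow> g 0) (at_right 0)" "(g \<longlongrightarrow> g 0) (at_left 0)"
    by (auto simp: filterlim_at_split)
  \<comment> \<open>\<open>s * g s \<le> 0\<close> on both sides of 0, so the one-sided limits of
    the continuous \<open>g\<close> force \<open>g 0 = 0\<close>.\<close>
  have "g 0 \<le> 0"
  proof (rule tendsto_upperbound[OF lim(1)])
    show "\<forall>\<^sub>F s in at_right 0. g s \<le> 0"
    proof -
      have "g s \<le> 0" if "0 < s" "s < 1 / R" for s using le0[of s] that by (simp add: mult_le_0_iff)
      then show ?thesis unfolding eventually_at_right_field using R by (intro exI[of _ "1 / R"]) auto
    qed
  qed simp
  moreover have "g 0 \<ge> 0"
  proof (rule tendsto_lowerbound[OF lim(2)])
    show "\<forall>\<^sub>F s in at_left 0. 0 \<le> g s"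
    proof -
      have "0 \<le> g s" if "s < 0" "- (1 / R) < s" for s
        using le0[of s] that by (simp add: mult_le_0_iff)
      then show ?thesis unfolding eventually_at_left_field using R by (intro exI[of _ "- (1 / R)"]) auto
    qed
  qed simp
  moreover have "A1 0 = A" using Ac by (auto simp: A1_def intro!: eq_matI)
  ultimately have "cofactor A p q + cofactor A q p = 0" by (simp add: g_def)
  moreover have "cofactor A q p = cofactor A p q" using cofactor_transpose[OF Ac pq(1,2)] by (simp add: AT')
  ultimately have cof0: "cofactor A q p = 0" by simp
  have d: "det A \<noteq> 0" using positive_definite_det_pos[OF Ac Apd] by simp
  obtain K' where K': "K' \<in> carrier_mat n n" "K' * A = 1\<^sub>m n" "K' $$ (p, q) = cofactor A q p / det A"
    using inverse_mat_exists[OF Ac d] pq by blast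
  have "K' = K' * (A * K)" using K' K by simp
  also have "\<dots> = K" using K' K Ac by (subst assoc_mult_mat[symmetric, of _ n n _ n]) auto
  finally show ?thesis using K'(3) cof0 by simp
qed

text \<open>Two maximizers agree at the specified positions, and their inverses vanish at the
  others; \<open>positive_definite_eqI\<close> identifies them, which gives the definite description
  its value.\<close>

lemma max_det_completion_props:
  assumes T: "T \<in> carrier_mat n n" and diag: "\<And>i. i < n \<Longrightarrow> T $$ (i, i) \<noteq> None"
    and symT: "\<And>i j. i < n \<Longrightarrow> j < n \<Longrightarrow> T $$ (i, j) = None \<Longrightarrow> T $$ (j, i) = None"
    and pdc: "pd_completable T"
  shows "is_pd_completion T (max_det_completion T)"
    and "\<exists>K \<in> carrier_mat n n. max_det_completion T * K = 1\<^sub>m n \<and>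
      (\<forall>i<n. \<forall>j<n. T $$ (i, j) = None \<longrightarrow> K $$ (i, j) = 0)"
proof -
  let ?opt = "\<lambda>A. is_pd_completion T A \<and> (\<forall>B. is_pd_completion T B \<longrightarrow> det B \<le> det A)"
  obtain A where A: "?opt A" using max_det_pd_completion_exists[OF T diag pdc] by blast
  have carr: "B \<in> carrier_mat n n" "positive_definite_mat B" if "?opt B" for B
    using that T by (auto simp: is_pd_completion_def is_completion_def)
  have inv: "\<exists>K \<in> carrier_mat n n. B * K = 1\<^sub>m n \<and> (\<forall>i<n. \<forall>j<n. T $$ (i, j) = None \<longrightarrow> K $$ (i, j) = 0)"
    if B: "?opt B" for B
  proof -
    obtain K where K: "K \<in> carrier_mat n n" "B * K = 1\<^sub>m n"
      using inverse_mat_exists[OF carr(1)[OF B]] positive_definite_det_pos[OF carr[OF B]] by auto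
    have "K $$ (i, j) = 0" if "i < n" "j < n" "T $$ (i, j) = None" for i j
      using that symT[OF that] diag[OF that(1)]
      by (intro max_det_inverse_zero[OF T conjunct1[OF B] _ K]) (use B in auto)
    then show ?thesis using K by blast
  qed
  have uniq: "B = A" if B: "?opt B" for B
  proof -
    obtain K where K: "K \<in> carrier_mat n n" "A * K = 1\<^sub>m n"
      "\<forall>i<n. \<forall>j<n. T $$ (i, j) = None \<longrightarrow> K $$ (i, j) = 0" using inv[OF A] by blast
    obtain L where L: "L \<in> carrier_mat n n" "B * L = 1\<^sub>m n"
      "\<forall>i<n. \<forall>j<n. T $$ (i, j) = None \<longrightarrow> L $$ (i, j) = 0" using inv[OF B] by blast
    show ?thesis
    proof (rule positive_definite_eqI[OF carr[OF B] carr[OF A] L(1,2) K(1,2)])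
      fix i j assume ij: "i < n" "j < n"
      show "B $$ (i, j) = A $$ (i, j) \<or> L $$ (i, j) = 0 \<and> K $$ (i, j) = 0"
      proof (cases "T $$ (i, j)")
        case None
        then show ?thesis using K L ij by simp
      next
        case (Some x)
        then show ?thesis using A B T ij by (auto simp: is_pd_completion_def is_completion_def)
      qed
    qed
  qed
  have eq: "max_det_completion T = A"
    unfolding max_det_completion_def by (rule the_equality[of ?opt, OF A uniq])
  show "is_pd_completion T (max_det_completion T)" using A eq by simp
  show "\<exists>K \<in> carrier_mat n n. max_det_completion T * K = 1\<^sub>m n \<and>
      (\<forall>i<n. \<forall>j<n. T $$ (i, j) = None \<longrightarrow> K $$ (i, j) = 0)" using inv[OF A] eq by simp
qed

section \<open>Toeplitz patterns\<close>

text \<open>A test vector is extended by 0 outside the range of \<open>f\<close>. An arbitrary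
  injection \<open>f\<close> covers deletion of the first or last index as well as reversal.\<close>

lemma positive_definite_submatrix:
  assumes A: "A \<in> carrier_mat n n" "positive_definite_mat A"
    and f: "inj_on f {..<m}" "f ` {..<m} \<subseteq> {..<n}"
  shows "positive_definite_mat (mat m m (\<lambda>(i, j). A $$ (f i, f j)))"
proof -
  note A' = A(2)[unfolded positive_definite_mat_iff[OF A(1)]]
  have fn: "f i < n" if "i < m" for i using f(2) that by auto
  show ?thesis
    unfolding positive_definite_mat_iff[OF mat_carrier]
  proof (intro conjI allI impI)
    fix i j assume "i < m" "j < m"
    then show "mat m m (\<lambda>(i, j). A $$ (f i, f j)) $$ (i, j) = mat m m (\<lambda>(i, j). A $$ (f i, f j)) $$ (j, i)"
      using conjunct1[OF A'] fn by simp
  next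
    fix v :: "nat \<Rightarrow> real" assume v: "\<exists>i<m. v i \<noteq> 0"
    define u where "u l = (if l \<in> f ` {..<m} then v (inv_into {..<m} f l) else 0)" for l
    have u: "u (f i) = v i" if "i < m" for i using that f(1) by (simp add: u_def)
    have red: "(\<Sum>l<n. g l) = (\<Sum>i<m. g (f i))" if "\<And>l. u l = 0 \<Longrightarrow> g l = 0" for g :: "nat \<Rightarrow> real"
    proof -
      have "(\<Sum>l<n. g l) = (\<Sum>l\<in>f ` {..<m}. g l)"
        using f(2) that by (intro sum.mono_neutral_right) (auto simp: u_def)
      then show ?thesis using f(1) by (simp add: sum.reindex)
    qed
    obtain i where "i < m" "v i \<noteq> 0" using v by blast
    then have "0 < (\<Sum>k<n. \<Sum>l<n. u k * A $$ (k, l) * u l)"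
      using u fn by (intro conjunct2[OF A', rule_format]) (metis)
    also have "\<dots> = (\<Sum>i<m. \<Sum>j<m. v i * A $$ (f i, f j) * v j)"
      by (subst red, simp, rule sum.cong[OF refl], subst red) (auto simp: u)
    finally show "0 < (\<Sum>i<m. \<Sum>j<m. v i * mat m m (\<lambda>(i, j). A $$ (f i, f j)) $$ (i, j) * v j)"
      by simp
  qed
qed

lemma positive_definite_diag_pos:
  assumes "A \<in> carrier_mat n n" "positive_definite_mat A" "i < n"
  shows "A $$ (i, i) > 0"
proof -
  have "unit_vec n i \<noteq> (0\<^sub>v n :: real vec)"
    using assms(3) by (metis index_unit_vec(1) index_zero_vec(1) zero_neq_one)
  then show ?thesis
    using assms(2)[unfolded positive_definite_mat_def, THEN conjunct2, rule_format, of "unit_vec n i"]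
      assms(1,3) by simp
qed

text \<open>Splitting off index \<open>r\<close> in \<open>A K = 1\<close> leaves the error
  \<open>A $$ (f i, r) * K $$ (r, k)\<close>; subtracting the right multiple of column
  \<open>r\<close> of \<open>K\<close> cancels it. The enumeration \<open>f\<close> lets any index
  be dropped.\<close>

lemma inverse_principal_submatrix:
  fixes A :: "real mat"
  assumes A: "A \<in> carrier_mat n n" and K: "K \<in> carrier_mat n n" "A * K = 1\<^sub>m n"
    and r: "r < n" "K $$ (r, r) \<noteq> 0" and f: "bij_betw f {..<m} ({..<n} - {r})"
  shows "mat m m (\<lambda>(i, j). A $$ (f i, f j)) *
    mat m m (\<lambda>(i, j). K $$ (f i, f j) - K $$ (f i, r) * K $$ (r, f j) / K $$ (r, r)) = 1\<^sub>m m"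
proof (rule eq_matI)
  have fn: "f i < n" "f i \<noteq> r" if "i < m" for i using f that by (auto simp: bij_betw_def)
  have split: "(\<Sum>l<n. g l) = g r + (\<Sum>i<m. g (f i))" for g :: "nat \<Rightarrow> real"
    using r(1) by (simp add: sum.remove[of _ r] sum.reindex_bij_betw[OF f])
  have AK: "(\<Sum>l<m. A $$ (f i, f l) * K $$ (f l, k)) = (if f i = k then 1 else 0) - A $$ (f i, r) * K $$ (r, k)"
    if "i < m" "k < n" for i k
  proof -
    have "(A * K) $$ (f i, k) = (if f i = k then 1 else 0)" unfolding K(2) using fn that by simp
    moreover have "(A * K) $$ (f i, k) = (\<Sum>l<n. A $$ (f i, l) * K $$ (l, k))"
      using that fn by (intro index_mult_mat_sum[OF A K(1)]) auto
    ultimately show ?thesis by (simp add: split)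
  qed
  fix i j assume "i < dim_row (1\<^sub>m m)" "j < dim_col (1\<^sub>m m :: real mat)"
  then have ij: "i < m" "j < m" by auto
  have "(mat m m (\<lambda>(i, j). A $$ (f i, f j)) *
      mat m m (\<lambda>(i, j). K $$ (f i, f j) - K $$ (f i, r) * K $$ (r, f j) / K $$ (r, r))) $$ (i, j)
      = (\<Sum>l<m. A $$ (f i, f l) * (K $$ (f l, f j) - K $$ (f l, r) * K $$ (r, f j) / K $$ (r, r)))"
    using ij by (subst index_mult_mat_sum[of _ m m _ m]) auto
  also have "\<dots> = (\<Sum>l<m. A $$ (f i, f l) * K $$ (f l, f j))
      - (\<Sum>l<m. A $$ (f i, f l) * K $$ (f l, r)) * (K $$ (r, f j) / K $$ (r, r))"
    by (simp add: right_diff_distrib sum_subtractf sum_distrib_right sum_divide_distrib mult.assoc)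
  also have "\<dots> = (if f i = f j then 1 else 0)"
    using ij fn r by (simp add: AK)
  also have "\<dots> = 1\<^sub>m m $$ (i, j)"
    using ij f by (auto simp: bij_betw_def inj_on_def)
  finally show "(mat m m (\<lambda>(i, j). A $$ (f i, f j)) *
      mat m m (\<lambda>(i, j). K $$ (f i, f j) - K $$ (f i, r) * K $$ (r, f j) / K $$ (r, r))) $$ (i, j)
      = 1\<^sub>m m $$ (i, j)" .
qed auto

lemma inverse_permuted:
  fixes A :: "real mat"
  assumes A: "A \<in> carrier_mat n n" and K: "K \<in> carrier_mat n n" "A * K = 1\<^sub>m n"
    and f: "bij_betw f {..<n} {..<n}"
  shows "mat n n (\<lambda>(i, j). A $$ (f i, f j)) * mat n n (\<lambda>(i, j). K $$ (f i, f j)) = 1\<^sub>m n"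
proof (rule eq_matI)
  have fn: "f i < n" if "i < n" for i using f that by (auto simp: bij_betw_def)
  fix i j assume "i < dim_row (1\<^sub>m n)" "j < dim_col (1\<^sub>m n :: real mat)"
  then have ij: "i < n" "j < n" by auto
  have "(mat n n (\<lambda>(i, j). A $$ (f i, f j)) * mat n n (\<lambda>(i, j). K $$ (f i, f j))) $$ (i, j)
      = (\<Sum>l<n. A $$ (f i, f l) * K $$ (f l, f j))"
    using ij by (subst index_mult_mat_sum[of _ n n _ n]) auto
  also have "\<dots> = (A * K) $$ (f i, f j)"
    unfolding sum.reindex_bij_betw[OF f, of "\<lambda>l. A $$ (f i, l) * K $$ (l, f j)"]
    using ij fn by (intro index_mult_mat_sum[OF A K(1), symmetric]) auto
  also have "\<dots> = 1\<^sub>m n $$ (i, j)"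
    unfolding K(2) using ij fn f by (auto simp: bij_betw_def inj_on_def)
  finally show "(mat n n (\<lambda>(i, j). A $$ (f i, f j)) * mat n n (\<lambda>(i, j). K $$ (f i, f j))) $$ (i, j)
      = 1\<^sub>m n $$ (i, j)" .
qed auto

section \<open>Toeplitz data and sufficiency of the pattern condition\<close>

lemma index_dist_eq: "index_dist i j = (if i \<le> j then j - i else i - j)"
  by (auto simp: index_dist_def)

lemma toeplitz_matI:
  assumes A: "A \<in> carrier_mat n n" and sym: "\<And>i j. i < n \<Longrightarrow> j < n \<Longrightarrow> A $$ (i, j) = A $$ (j, i)"
    and shift: "\<And>i j. Suc i < n \<Longrightarrow> Suc j < n \<Longrightarrow> A $$ (Suc i, Suc j) = A $$ (i, j)"
  shows "toeplitz_mat A"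
proof -
  have *: "A $$ (i, i + d) = A $$ (0, d)" if "i + d < n" for i d
    using that by (induction i) (auto simp: shift)
  have "A $$ (i, j) = A $$ (0, index_dist i j)" if "i < n" "j < n" for i j
    using *[of i "j - i"] *[of j "i - j"] sym[of i j] that by (auto simp: index_dist_eq)
  then show ?thesis using A by (auto simp: toeplitz_mat_def)
qed

lemma partial_toeplitz_mat_props:
  shows "partial_toeplitz_mat n P t \<in> carrier_mat n n"
    and "i < n \<Longrightarrow> partial_toeplitz_mat n P t $$ (i, i) \<noteq> None"
    and "i < n \<Longrightarrow> j < n \<Longrightarrow> partial_toeplitz_mat n P t $$ (i, j) = None \<Longrightarrow>
      partial_toeplitz_mat n P t $$ (j, i) = None"
    and "i < n \<Longrightarrow> j < n \<Longrightarrow>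
      partial_toeplitz_mat n P t $$ (i, j) = None \<longleftrightarrow> i \<noteq> j \<and> index_dist i j \<notin> P"
  by (auto simp: partial_toeplitz_mat_def index_dist_eq split: if_splits)

lemma pd_completion_toeplitz_entry:
  assumes "is_pd_completion (partial_toeplitz_mat n P t) A" "i < n" "j < n" "i = j \<or> index_dist i j \<in> P"
  shows "A $$ (i, j) = t (index_dist i j)"
  using assms by (auto simp: is_pd_completion_def is_completion_def partial_toeplitz_mat_def index_dist_eq)

lemma partial_toeplitz_max_det:
  assumes "pd_completable (partial_toeplitz_mat n P t)"
  obtains K where "is_pd_completion (partial_toeplitz_mat n P t) (max_det_completion (partial_toeplitz_mat n P t))"
    and "max_det_completion (partial_toeplitz_mat n P t) \<in> carrier_mat n n"
    and "positive_definite_mat (max_det_completion (partial_toeplitz_mat n P t))"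
    and "K \<in> carrier_mat n n" and "max_det_completion (partial_toeplitz_mat n P t) * K = 1\<^sub>m n"
    and "\<And>i j. i < n \<Longrightarrow> j < n \<Longrightarrow> i \<noteq> j \<Longrightarrow> index_dist i j \<notin> P \<Longrightarrow> K $$ (i, j) = 0"
proof -
  let ?T = "partial_toeplitz_mat n P t"
  note T = partial_toeplitz_mat_props(1)[of n P t]
  have pd: "is_pd_completion ?T (max_det_completion ?T)"
    by (rule max_det_completion_props(1)[OF T partial_toeplitz_mat_props(2) partial_toeplitz_mat_props(3) assms])
  have "\<exists>K \<in> carrier_mat n n. max_det_completion ?T * K = 1\<^sub>m n \<and>
      (\<forall>i<n. \<forall>j<n. ?T $$ (i, j) = None \<longrightarrow> K $$ (i, j) = 0)"
    by (rule max_det_completion_props(2)[OF T partial_toeplitz_mat_props(2) partial_toeplitz_mat_props(3) assms])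
  then obtain K where K: "K \<in> carrier_mat n n" "max_det_completion ?T * K = 1\<^sub>m n"
    "\<forall>i<n. \<forall>j<n. ?T $$ (i, j) = None \<longrightarrow> K $$ (i, j) = 0" by blast
  show thesis
    using pd T by (intro that[OF pd _ _ K(1,2)])
      (simp_all add: is_pd_completion_def is_completion_def K(3) partial_toeplitz_mat_props(4))
qed

text \<open>The two principal submatrices of order \<open>n - 1\<close> obtained by dropping the last or the first index
  have inverses given by Schur complements. The fill-in produced by dropping the last index sits at
  \<open>(n - 1 - p, n - 1 - q)\<close>, that produced by dropping the first one at \<open>(p - 1, q - 1)\<close>, for
  \<open>p, q \<in> P\<close>. If \<open>p + q = n\<close> whenever \<open>\<bar>p - q\<bar>\<close> is unspecified, these positions agree, and the
  values there agree because the completion is persymmetric; so the submatrices coincide.\<close>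

lemma max_det_completion_toeplitz:
  assumes pdc: "pd_completable (partial_toeplitz_mat n P t)"
    and star: "\<And>p q. p \<in> P \<Longrightarrow> q \<in> P \<Longrightarrow> p < q \<Longrightarrow> q - p \<in> P \<or> p + q = n"
  shows "toeplitz_mat (max_det_completion (partial_toeplitz_mat n P t))"
proof (cases n)
  case 0
  then have "max_det_completion (partial_toeplitz_mat n P t) \<in> carrier_mat 0 0"
    using partial_toeplitz_max_det[OF pdc] by metis
  then show ?thesis by (auto simp: toeplitz_mat_def)
next
  case (Suc m)
  define T where "T = partial_toeplitz_mat n P t"
  define A where "A = max_det_completion T"
  obtain K where pdA: "is_pd_completion T A" and A: "A \<in> carrier_mat n n" "positive_definite_mat A"
    and K: "K \<in> carrier_mat n n" "A * K = 1\<^sub>m n"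
    and Kz: "\<And>i j. i < n \<Longrightarrow> j < n \<Longrightarrow> i \<noteq> j \<Longrightarrow> index_dist i j \<notin> P \<Longrightarrow> K $$ (i, j) = 0"
    by (rule partial_toeplitz_max_det[OF pdc, folded T_def, folded A_def]) (rule that; assumption)
  have Asym: "A $$ (i, j) = A $$ (j, i)" if "i < n" "j < n" for i j
    using A(2)[unfolded positive_definite_mat_iff[OF A(1)]] that by blast
  have At: "A $$ (i, j) = t (index_dist i j)" if "i < n" "j < n" "i = j \<or> index_dist i j \<in> P" for i j
    using pd_completion_toeplitz_entry[OF pdA[unfolded T_def] that] .
  have Kpos: "K $$ (i, i) \<noteq> 0" if "i < n" for i
    using positive_definite_diag_pos[OF K(1) positive_definite_inverse[OF A K] that] by simp
  let ?sub = "\<lambda>m f (M :: real mat). mat m m (\<lambda>(i, j). M $$ (f i, f j))"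
  \<comment> \<open>Reversing the order of the indices preserves both the data and the zero pattern
    of the inverse, so by uniqueness it fixes \<open>A\<close>.\<close>
  have flip: "A $$ (m - i, m - j) = A $$ (i, j)" if ij: "i < n" "j < n" for i j
  proof -
    define f where "f i = m - i" for i
    have bij: "bij_betw f {..<n} {..<n}"
      by (rule bij_betw_byWitness[of _ f]) (auto simp: f_def Suc)
    have fd: "f i < n" "index_dist (f i) (f j) = index_dist i j" "f i = f j \<longleftrightarrow> i = j"
      if "i < n" "j < n" for i j
      using that by (auto simp: f_def Suc index_dist_eq)
    have "?sub n f A = A"
    proof (rule positive_definite_eqI[OF _ _ A _ inverse_permuted[OF A(1) K bij] K])
      show "positive_definite_mat (?sub n f A)"
        using bij by (intro positive_definite_submatrix[OF A]) (auto simp: bij_betw_def)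
      fix i j assume ij: "i < n" "j < n"
      show "?sub n f A $$ (i, j) = A $$ (i, j) \<or> ?sub n f K $$ (i, j) = 0 \<and> K $$ (i, j) = 0"
        using ij fd[OF ij] fd[OF ij(2,1)] At[of i j] At[of "f i" "f j"] Kz[of i j] Kz[of "f i" "f j"]
        by (cases "i = j \<or> index_dist i j \<in> P") auto
    qed auto
    then have "?sub n f A $$ (i, j) = A $$ (i, j)" by simp
    then show ?thesis using ij by (simp add: f_def)
  qed
  have bij1: "bij_betw (\<lambda>i. i) {..<m} ({..<n} - {m})" by (auto simp: bij_betw_def Suc)
  have bij2: "bij_betw Suc {..<m} ({..<n} - {0})"
    by (rule bij_betw_byWitness[of _ "\<lambda>i. i - 1"]) (auto simp: Suc)
  note inv1 = inverse_principal_submatrix[OF A(1) K _ Kpos bij1]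
  note inv2 = inverse_principal_submatrix[OF A(1) K _ Kpos bij2]
  have "?sub m (\<lambda>i. i) A = ?sub m Suc A"
  proof (rule positive_definite_eqI[OF _ _ _ _ _ inv1 _ inv2])
    show "positive_definite_mat (?sub m (\<lambda>i. i) A)" "positive_definite_mat (?sub m Suc A)"
      using positive_definite_submatrix[OF A, of "\<lambda>i. i" m] positive_definite_submatrix[OF A, of Suc m] Suc
      by (simp_all add: image_subset_iff)
    fix i j assume ij: "i < m" "j < m"
    have ijn: "i < n" "j < n" "Suc i < n" "Suc j < n" "m < n" "0 < n" using ij Suc by auto
    have dS: "index_dist (Suc i) (Suc j) = index_dist i j" by (simp add: index_dist_eq)
    show "?sub m (\<lambda>i. i) A $$ (i, j) = ?sub m Suc A $$ (i, j) \<or>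
      mat m m (\<lambda>(i, j). K $$ (i, j) - K $$ (i, m) * K $$ (m, j) / K $$ (m, m)) $$ (i, j) = 0 \<and>
      mat m m (\<lambda>(i, j). K $$ (Suc i, Suc j) - K $$ (Suc i, 0) * K $$ (0, Suc j) / K $$ (0, 0)) $$ (i, j) = 0"
    \<comment> \<open>For position \<open>(i, j)\<close> the distances to the last index
      \<open>m\<close> are \<open>m - i\<close> and \<open>m - j\<close>, those of the shifted
      position to index 0 are \<open>Suc i\<close> and \<open>Suc j\<close>. Either pair sums to
      \<open>n\<close> exactly when \<open>i + j + 1 = m\<close>, and there
      \<open>m - i = Suc j\<close> and \<open>m - j = Suc i\<close>.\<close>
    proof (cases "i = j \<or> index_dist i j \<in> P \<or> i + j + 1 = m")
      case True
      have "A $$ (i, j) = A $$ (Suc i, Suc j)"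
      proof (cases "i + j + 1 = m")
        case eq: True
        then have "A $$ (m - i, m - j) = A $$ (Suc j, Suc i)" by (intro arg_cong[of _ _ "\<lambda>p. A $$ p"]) auto
        then show ?thesis using flip[OF ijn(1,2)] Asym[OF ijn(3,4)] by simp
      next
        case False
        then show ?thesis using True At[of i j] At[of "Suc i" "Suc j"] ijn dS by auto
      qed
      then show ?thesis using ij by simp
    next
      case False
      then have ne: "i \<noteq> j" "index_dist i j \<notin> P" "i + j + 1 \<noteq> m" by auto
      have K0: "K $$ (i, j) = 0" "K $$ (Suc i, Suc j) = 0"
        using Kz[of i j] Kz[of "Suc i" "Suc j"] ne ijn dS by auto
      have last: "K $$ (i, m) = 0 \<or> K $$ (m, j) = 0"
      proof (rule ccontr)
        assume "\<not> ?thesis"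
        then have "m - i \<in> P" "m - j \<in> P"
          using Kz[of i m] Kz[of m j] ij ijn by (auto simp: index_dist_eq)
        moreover have "m - j < m - i \<and> m - i - (m - j) = index_dist i j \<or>
            m - i < m - j \<and> m - j - (m - i) = index_dist i j"
          using ne(1) ij by (auto simp: index_dist_eq)
        ultimately have "m - i + (m - j) = n"
          using star[of "m - i" "m - j"] star[of "m - j" "m - i"] ne(2) by auto
        then show False using ne(3) ij Suc by auto
      qed
      have first: "K $$ (Suc i, 0) = 0 \<or> K $$ (0, Suc j) = 0"
      proof (rule ccontr)
        assume "\<not> ?thesis"
        then have "Suc i \<in> P" "Suc j \<in> P"
          using Kz[of "Suc i" 0] Kz[of 0 "Suc j"] ij ijn by (auto simp: index_dist_eq)
        moreover have "j < i \<and> Suc i - Suc j = index_dist i j \<or> i < j \<and> Suc j - Suc i = index_dist i j"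
          using ne(1) by (auto simp: index_dist_eq)
        ultimately have "Suc i + Suc j = n"
          using star[of "Suc i" "Suc j"] star[of "Suc j" "Suc i"] ne(2) by auto
        then show False using ne(3) Suc by auto
      qed
      show ?thesis using K0 last first ij by auto
    qed
  qed (use Suc in auto)
  then have eq: "?sub m (\<lambda>i. i) A $$ (i, j) = ?sub m Suc A $$ (i, j)" for i j by simp
  have "A $$ (Suc i, Suc j) = A $$ (i, j)" if "Suc i < n" "Suc j < n" for i j
    using eq[of i j] that Suc by simp
  then show ?thesis using toeplitz_matI[OF A(1) Asym] unfolding A_def T_def by blast
qed

section \<open>Combinatorics of the pattern\<close>

text \<open>With \<open>k\<close> the least element, the condition for the pair \<open>k\<close>,
  \<open>p\<close> says that \<open>P\<close> is closed under subtracting \<open>k\<close>, except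
  possibly at \<open>k\<close> itself and at \<open>n - k\<close>. So \<open>P\<close> is a run of
  multiples of \<open>k\<close>, and the three forms differ in how \<open>n - k\<close> sits
  relative to that run.\<close>

lemma pattern_form_iff:
  fixes n :: nat and P :: "nat set"
  assumes ne: "P \<noteq> {}" and P: "P \<subseteq> {1..n - 1}"
  shows "(\<forall>p\<in>P. \<forall>q\<in>P. p < q \<longrightarrow> q - p \<in> P \<or> p + q = n) \<longleftrightarrow>
    (\<exists>r k :: nat. r > 0 \<and> k > 0 \<and>
            (P = (\<lambda>j. j * k) ` {1..r}
             \<or> (P = (\<lambda>j. j * k) ` {1..r - 2} \<union> {r * k} \<and> n = (r + 1) * k)
             \<or> P = {k, n - k}))" (is "?star \<longleftrightarrow> ?forms")
proof
  assume star: ?star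
  define k where "k = (LEAST x. x \<in> P)"
  have k: "k \<in> P" unfolding k_def using ne by (auto intro: LeastI)
  have kmin: "k \<le> p" if "p \<in> P" for p unfolding k_def using that by (rule Least_le)
  have bound: "p < n" "p \<ge> 1" if "p \<in> P" for p using subsetD[OF P that] by auto
  have k1: "k \<ge> 1" "k < n" using bound[OF k] by auto
  have down: "p - k \<in> P" if "p \<in> P" "p \<noteq> k" "p \<noteq> n - k" for p
    using star[rule_format, of k p] k that kmin[of p] k1 by fastforce
  \<comment> \<open>The side condition keeps the descent by \<open>k\<close> away from the
    exceptional element \<open>n - k\<close>, so that it ends at \<open>k\<close>.\<close>
  have mult: "\<exists>j\<ge>1. p = j * k" if p: "p \<in> P" and nk: "n - k \<notin> P \<or> p < n - k" for p
    using p nk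
  proof (induction p rule: less_induct)
    case (less p)
    show ?case
    proof (cases "p = k")
      case True
      then show ?thesis by (intro exI[of _ 1]) simp
    next
      case False
      moreover have "p \<noteq> n - k" using less.prems by auto
      ultimately have pk: "p - k \<in> P" using down less.prems by blast
      moreover have "k < p" using kmin[OF less.prems(1)] False by simp
      moreover have "n - k \<notin> P \<or> p - k < n - k" using less.prems by auto
      ultimately obtain j where "j \<ge> 1" "p - k = j * k" using less.IH[of "p - k"] k1 by auto
      then show ?thesis using \<open>k < p\<close> by (intro exI[of _ "Suc j"]) auto
    qed
  qed
  have down_closed: "i * k \<in> P" if "j * k \<in> P" "n - k \<notin> P \<or> j * k < n - k" "1 \<le> i" "i \<le> j" for i j
    using that
  proof (induction j)
    case (Suc j)
    show ?case
    proof (cases "i = Suc j")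
      case False
      then have "j \<ge> 1" using Suc.prems by auto
      then have "Suc j * k \<noteq> k" "Suc j * k \<noteq> n - k" using k1 Suc.prems by auto
      then have "j * k \<in> P" using down[OF Suc.prems(1)] by simp
      then show ?thesis using Suc False by auto
    qed (use Suc in simp)
  qed simp
  define R where "R = {j. j \<ge> 1 \<and> j * k \<in> P \<and> (n - k \<notin> P \<or> j * k < n - k)}"
  have "R \<subseteq> {..n}"
  proof
    fix j assume "j \<in> R"
    then have "j * k < n" using bound by (auto simp: R_def)
    moreover have "j \<le> j * k" using k1 by simp
    ultimately have "j < n" by linarith
    then show "j \<in> {..n}" by simp
  qed
  then have finR: "finite R" by (rule finite_subset) simp
  show ?forms
  proof (cases "n - k \<in> P \<and> n - k \<noteq> k")
    case False
    have "n - k \<notin> P \<or> P = {k}"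
    proof (rule disjCI)
      assume "\<not> P = {k}"
      show "n - k \<notin> P"
      proof
        assume "n - k \<in> P"
        then have nk: "n - k = k" using False by blast
        obtain p where p: "p \<in> P" "p \<noteq> k" using \<open>P \<noteq> {k}\<close> k by blast
        then have "p - k \<in> P" "k < p" using down nk kmin[of p] by auto
        then show False using kmin[of "p - k"] bound[OF p(1)] nk by auto
      qed
    qed
    then show ?thesis
    proof
      assume "P = {k}"
      then show ?thesis using k1 by (intro exI[of _ 1] exI[of _ k]) simp
    next
      assume nk: "n - k \<notin> P"
      have Rne: "1 \<in> R" using k nk by (simp add: R_def)
      define r where "r = Max R"
      have r: "r \<in> R" "\<And>j. j \<in> R \<Longrightarrow> j \<le> r" using finR Rne by (auto simp: r_def intro: Max_in)
      have "P = (\<lambda>j. j * k) ` {1..r}"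
      proof (intro subset_antisym subsetI)
        fix p assume "p \<in> P"
        then obtain j where j: "j \<ge> 1" "p = j * k" using mult nk by blast
        then have "j \<in> R" using \<open>p \<in> P\<close> nk by (simp add: R_def)
        then show "p \<in> (\<lambda>j. j * k) ` {1..r}" using r(2) j by (intro image_eqI[of _ _ j]) simp_all
      next
        fix p assume "p \<in> (\<lambda>j. j * k) ` {1..r}"
        then show "p \<in> P" using down_closed[of r] r(1) by (auto simp: R_def)
      qed
      moreover have "r > 0" "k > 0" using r(1) k1 by (simp_all add: R_def)
      ultimately show ?thesis by blast
    qed
  next
    case True
    then have nkP: "n - k \<in> P" and nkk: "k < n - k" using kmin[of "n - k"] by auto
    \<comment> \<open>For \<open>p > n - k\<close> the difference to \<open>n - k\<close> is below
      the minimum \<open>k\<close>, and the sum with \<open>n - k\<close> exceeds \<open>n\<close>,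
      so the condition fails.\<close>
    have top: "p \<le> n - k" if p: "p \<in> P" for p
    proof (rule ccontr)
      assume "\<not> p \<le> n - k"
      then have gt: "n - k < p" by simp
      have "p - (n - k) \<in> P \<or> n - k + p = n" using star[rule_format, OF nkP p gt] .
      moreover have "p - (n - k) < k" using bound[OF p] k1 gt by linarith
      moreover have "n - k + p \<noteq> n" using gt nkk k1 by auto
      ultimately show False using kmin[of "p - (n - k)"] by auto
    qed
    have Rne: "1 \<in> R" using k nkk by (simp add: R_def)
    define s where "s = Max R"
    have s: "s \<in> R" "\<And>j. j \<in> R \<Longrightarrow> j \<le> s" using finR Rne by (auto simp: s_def intro: Max_in)
    have s1: "s \<ge> 1" "s * k < n - k" using s(1) nkP by (auto simp: R_def)
    have Peq: "P = (\<lambda>j. j * k) ` {1..s} \<union> {n - k}"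
    proof (intro subset_antisym subsetI)
      fix p assume p: "p \<in> P"
      show "p \<in> (\<lambda>j. j * k) ` {1..s} \<union> {n - k}"
      proof (cases "p = n - k")
        case False
        then have lt: "p < n - k" using top[OF p] by simp
        then obtain j where j: "j \<ge> 1" "p = j * k" using mult p by blast
        then have "j \<in> R" using p lt by (simp add: R_def)
        then show ?thesis using s(2) j by (intro UnI1 image_eqI[of _ _ j]) simp_all
      qed simp
    next
      fix p assume "p \<in> (\<lambda>j. j * k) ` {1..s} \<union> {n - k}"
      then show "p \<in> P" using down_closed[of s] s(1) nkP by (auto simp: R_def)
    qed
    show ?thesis
    proof (cases "s = 1")
      case True
      then have "P = {k, n - k}" using Peq by auto
      \<comment> \<open>The third form does not mention \<open>r\<close>; 1 is an arbitrary positive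
        value.\<close>
      then show ?thesis using k1 by (intro exI[of _ 1] exI[of _ k] conjI disjI2) simp_all
    next
      case False
      then have s2: "s \<ge> 2" using s1 by simp
      then have "2 * k \<in> P" by (subst Peq, intro UnI1 image_eqI[of _ _ 2]) simp_all
      moreover have "2 * k \<le> s * k" using s2 by simp
      then have lt: "2 * k < n - k" using s1 by linarith
      \<comment> \<open>The condition for \<open>2 * k\<close> and \<open>n - k\<close>, whose sum
        is \<open>n + k\<close>: the difference lies in \<open>P\<close>, which makes
        \<open>n - k\<close> a multiple of \<open>k\<close>.\<close>
      ultimately have "n - k - 2 * k \<in> P"
        using star[rule_format, of "2 * k" "n - k"] nkP k1 by linarith
      moreover have "n - k - 2 * k \<noteq> n - k" using k1 lt by linarith
      ultimately have "n - k - 2 * k \<in> (\<lambda>j. j * k) ` {1..s}" by (subst (asm) Peq) blast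
      then obtain j where j: "1 \<le> j" "j \<le> s" "n - k - 2 * k = j * k" by auto
      then have nk: "n - k = (j + 2) * k" using lt by (simp add: algebra_simps)
      then have "s * k < (j + 2) * k" using s1 by simp
      then have "s < j + 2" using mult_less_cancel2 by blast
      \<comment> \<open>\<open>n - k\<close> is \<open>(j + 2) * k\<close>: for \<open>j = s\<close>
        one multiple is skipped, which is the second form with \<open>r = s + 2\<close>; for
        \<open>Suc j = s\<close> it continues the run, which is the first form.\<close>
      then consider "j = s" | "Suc j = s" using j by linarith
      then show ?thesis
      proof cases
        case 1
        have "P = (\<lambda>j. j * k) ` {1..(s + 2) - 2} \<union> {(s + 2) * k}" "n = ((s + 2) + 1) * k"
          using Peq nk 1 k1 by (simp_all add: algebra_simps)
        then show ?thesis using k1 by (intro exI[of _ "s + 2"] exI[of _ k] conjI disjI2 disjI1) auto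
      next
        case 2
        then have "n - k = Suc s * k" using nk by auto
        then have "P = (\<lambda>j. j * k) ` {1..Suc s}" using Peq by (simp add: atLeastAtMostSuc_conv)
        moreover have "Suc s > 0" "k > 0" using k1 by simp_all
        ultimately show ?thesis by blast
      qed
    qed
  qed
next
  assume ?forms
  then obtain r k where rk: "r > 0" "k > 0"
    and cases: "P = (\<lambda>j. j * k) ` {1..r}
             \<or> (P = (\<lambda>j. j * k) ` {1..r - 2} \<union> {r * k} \<and> n = (r + 1) * k)
             \<or> P = {k, n - k}" by blast
  have sub: "b * k - a * k = (b - a) * k" for a b by (simp add: diff_mult_distrib)
  from cases show ?star
  proof (elim disjE conjE)
    assume PP: "P = (\<lambda>j. j * k) ` {1..r}"
    show ?star
    proof (intro ballI impI)
      fix p q assume "p \<in> P" "q \<in> P" "p < q"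
      then obtain a b where "p = a * k" "q = b * k" "1 \<le> a" "a < b" "b \<le> r" unfolding PP by auto
      then have "q - p = (b - a) * k" "b - a \<in> {1..r}" by (auto simp: sub)
      then show "q - p \<in> P \<or> p + q = n" unfolding PP by blast
    qed
  next
    assume PP: "P = (\<lambda>j. j * k) ` {1..r - 2} \<union> {r * k}" and n: "n = (r + 1) * k"
    show ?star
    proof (intro ballI impI)
      fix p q assume pq: "p \<in> P" "q \<in> P" "p < q"
      then obtain b where b: "q = b * k" "b \<in> {1..r - 2} \<or> b = r" unfolding PP by auto
      obtain a where a: "p = a * k" "a \<in> {1..r - 2} \<or> a = r" using pq unfolding PP by auto
      have ab: "a < b" using pq a b by simp
      then have "q - p = (b - a) * k" using a b by (simp add: sub)
      \<comment> \<open>The only multiplier that a difference can reach outside the pattern is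
        \<open>r - 1\<close>, from the pair \<open>k\<close>, \<open>r * k\<close>, and this pair
        sums to \<open>n\<close>.\<close>
      moreover have "b - a \<in> {1..r - 2} \<or> (a = 1 \<and> b = r)" using a b ab by auto
      moreover have "p + q = n" if "a = 1" "b = r" using that a b n by simp
      ultimately show "q - p \<in> P \<or> p + q = n" unfolding PP by blast
    qed
  next
    assume PP: "P = {k, n - k}"
    then have "k < n" using P rk by auto
    then show ?star unfolding PP by auto
  qed
qed

section \<open>Inverses of Toeplitz matrices\<close>

lemma inverse_mat_unique:
  fixes A :: "real mat"
  assumes "A \<in> carrier_mat n n" "K \<in> carrier_mat n n" "L \<in> carrier_mat n n"
    and "A * K = 1\<^sub>m n" "A * L = 1\<^sub>m n"
  shows "K = L"
proof -
  have "K * A = 1\<^sub>m n" using mat_mult_left_right_inverse assms by blast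
  then have "L = K * A * L" using assms by simp
  also have "\<dots> = K * (A * L)" using assms by (intro assoc_mult_mat[of _ n n _ n]) auto
  finally show ?thesis using assms by simp
qed

lemma toeplitz_inverse_persymmetric:
  fixes A :: "real mat"
  assumes A: "A \<in> carrier_mat (Suc m) (Suc m)" "toeplitz_mat A"
    and K: "K \<in> carrier_mat (Suc m) (Suc m)" "A * K = 1\<^sub>m (Suc m)" and ij: "i \<le> m" "j \<le> m"
  shows "K $$ (m - i, m - j) = K $$ (i, j)"
proof -
  obtain t where t: "\<And>i j. i < Suc m \<Longrightarrow> j < Suc m \<Longrightarrow> A $$ (i, j) = t (index_dist i j)"
    using A by (auto simp: toeplitz_mat_def)
  define f where "f i = m - i" for i
  have bij: "bij_betw f {..<Suc m} {..<Suc m}"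
    by (rule bij_betw_byWitness[of _ f]) (auto simp: f_def)
  have "mat (Suc m) (Suc m) (\<lambda>(i, j). A $$ (f i, f j)) = A"
  proof (rule eq_matI)
    fix i j assume "i < dim_row A" "j < dim_col A"
    then have ij: "i < Suc m" "j < Suc m" using A by auto
    have "index_dist (f i) (f j) = index_dist i j" using ij by (auto simp: f_def index_dist_eq)
    then show "mat (Suc m) (Suc m) (\<lambda>(i, j). A $$ (f i, f j)) $$ (i, j) = A $$ (i, j)"
      using ij t[of i j] t[of "f i" "f j"] by (simp add: f_def)
  qed (use A in auto)
  then have "mat (Suc m) (Suc m) (\<lambda>(i, j). K $$ (f i, f j)) = K"
    using inverse_permuted[OF A(1) K bij] by (intro inverse_mat_unique[OF A(1) _ K(1) _ K(2)]) auto
  then have "mat (Suc m) (Suc m) (\<lambda>(i, j). K $$ (f i, f j)) $$ (i, j) = K $$ (i, j)" by simp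
  then show ?thesis using ij by (simp add: f_def)
qed

text \<open>An instance of the Gohberg--Semencul formula.\<close>

lemma toeplitz_inverse_shift:
  fixes A :: "real mat"
  assumes A: "A \<in> carrier_mat (Suc m) (Suc m)" "toeplitz_mat A" "positive_definite_mat A"
    and K: "K \<in> carrier_mat (Suc m) (Suc m)" "A * K = 1\<^sub>m (Suc m)" and ij: "i < m" "j < m"
  shows "K $$ (i, j) - K $$ (m - i, 0) * K $$ (m - j, 0) / K $$ (0, 0) =
    K $$ (Suc i, Suc j) - K $$ (Suc i, 0) * K $$ (Suc j, 0) / K $$ (0, 0)"
proof -
  obtain t where t: "\<And>i j. i < Suc m \<Longrightarrow> j < Suc m \<Longrightarrow> A $$ (i, j) = t (index_dist i j)"
    using A by (auto simp: toeplitz_mat_def)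
  have pdK: "positive_definite_mat K" using positive_definite_inverse[OF A(1,3) K] .
  have Kpos: "K $$ (i, i) \<noteq> 0" if "i < Suc m" for i
    using positive_definite_diag_pos[OF K(1) pdK that] by simp
  have Ksym: "K $$ (i, j) = K $$ (j, i)" if "i < Suc m" "j < Suc m" for i j
    using pdK[unfolded positive_definite_mat_iff[OF K(1)]] that by blast
  have flip: "K $$ (m - i, m - j) = K $$ (i, j)" if "i \<le> m" "j \<le> m" for i j
    using toeplitz_inverse_persymmetric[OF A(1,2) K that] .
  have bij1: "bij_betw (\<lambda>i. i) {..<m} ({..<Suc m} - {m})" by (auto simp: bij_betw_def)
  have bij2: "bij_betw Suc {..<m} ({..<Suc m} - {0})"
    by (rule bij_betw_byWitness[of _ "\<lambda>i. i - 1"]) auto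
  \<comment> \<open>The leading and trailing submatrices of order \<open>m\<close> coincide, so
    their inverses, the two Schur complements, do as well.\<close>
  have eq: "mat m m (\<lambda>(i, j). A $$ (Suc i, Suc j)) = mat m m (\<lambda>(i, j). A $$ (i, j))"
    using t by (auto simp: index_dist_eq intro!: eq_matI)
  let ?K1 = "mat m m (\<lambda>(i, j). K $$ (i, j) - K $$ (i, m) * K $$ (m, j) / K $$ (m, m))"
  let ?K2 = "mat m m (\<lambda>(i, j). K $$ (Suc i, Suc j) - K $$ (Suc i, 0) * K $$ (0, Suc j) / K $$ (0, 0))"
  have "?K1 = ?K2"
  proof (rule inverse_mat_unique)
    show "mat m m (\<lambda>(i, j). A $$ (i, j)) * ?K1 = 1\<^sub>m m"
      by (rule inverse_principal_submatrix[OF A(1) K _ Kpos bij1]) auto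
    have "mat m m (\<lambda>(i, j). A $$ (Suc i, Suc j)) * ?K2 = 1\<^sub>m m"
      by (rule inverse_principal_submatrix[OF A(1) K _ Kpos bij2]) auto
    then show "mat m m (\<lambda>(i, j). A $$ (i, j)) * ?K2 = 1\<^sub>m m" unfolding eq .
  qed auto
  then have "?K1 $$ (i, j) = ?K2 $$ (i, j)" by simp
  \<comment> \<open>Persymmetry turns the last row and column of \<open>K\<close> into entries of
    its first column.\<close>
  moreover have "K $$ (i, m) = K $$ (m - i, 0)" "K $$ (m, j) = K $$ (m - j, 0)"
      "K $$ (m, m) = K $$ (0, 0)" "K $$ (0, Suc j) = K $$ (Suc j, 0)"
    using flip[of i m] flip[of j m] flip[of m m] Ksym[of m j] Ksym[of 0 "Suc j"] ij by auto
  ultimately show ?thesis using ij by simp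
qed

section \<open>Perturbation of the identity\<close>

text \<open>Each product \<open>v i * v j\<close> is bounded by the mean of the two squares; summed
  over all pairs this costs at most \<open>n * e\<close> times the squared norm.\<close>

lemma unit_diagonal_positive_definite:
  fixes A :: "real mat"
  assumes A: "A \<in> carrier_mat n n" and sym: "\<And>i j. i < n \<Longrightarrow> j < n \<Longrightarrow> A $$ (i, j) = A $$ (j, i)"
    and diag: "\<And>i. i < n \<Longrightarrow> A $$ (i, i) = 1"
    and small: "\<And>i j. i < n \<Longrightarrow> j < n \<Longrightarrow> i \<noteq> j \<Longrightarrow> \<bar>A $$ (i, j)\<bar> \<le> e"
    and e: "0 \<le> e" "n * e < 1"
  shows "positive_definite_mat A"
  unfolding positive_definite_mat_iff[OF A]
proof (intro conjI allI impI)
  fix v :: "nat \<Rightarrow> real" assume v: "\<exists>i<n. v i \<noteq> 0"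
  define N where "N = (\<Sum>i<n. (v i)\<^sup>2)"
  have "N > 0" unfolding N_def using v by (auto intro: sum_pos2)
  then have "0 < N - n * e * N" using e by (simp add: algebra_simps)
  also have "\<dots> = (\<Sum>i<n. \<Sum>j<n. (if i = j then (v i)\<^sup>2 else 0) - e * ((v i)\<^sup>2 + (v j)\<^sup>2) / 2)"
    by (simp add: sum_subtractf sum.distrib distrib_left add_divide_distrib N_def
        sum_distrib_left[symmetric] sum_divide_distrib[symmetric])
  also have "\<dots> \<le> (\<Sum>i<n. \<Sum>j<n. v i * A $$ (i, j) * v j)"
  proof (intro sum_mono)
    fix i j assume "i \<in> {..<n}" "j \<in> {..<n}"
    then have ij: "i < n" "j < n" by auto
    show "(if i = j then (v i)\<^sup>2 else 0) - e * ((v i)\<^sup>2 + (v j)\<^sup>2) / 2 \<le> v i * A $$ (i, j) * v j"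
    proof (cases "i = j")
      case True
      then show ?thesis using diag ij e by (simp add: power2_eq_square)
    next
      case False
      have "\<bar>v i * v j\<bar> \<le> ((v i)\<^sup>2 + (v j)\<^sup>2) / 2"
        using sum_squares_bound[of "v i" "v j"] sum_squares_bound[of "- v i" "v j"] by (simp add: abs_le_iff)
      then have "\<bar>A $$ (i, j)\<bar> * \<bar>v i * v j\<bar> \<le> e * (((v i)\<^sup>2 + (v j)\<^sup>2) / 2)"
        using small[OF ij False] e by (intro mult_mono) auto
      then have "\<bar>v i * A $$ (i, j) * v j\<bar> \<le> e * ((v i)\<^sup>2 + (v j)\<^sup>2) / 2"
        by (simp add: abs_mult mult_ac)
      then show ?thesis using False by (simp add: abs_le_iff)
    qed
  qed
  finally show "0 < (\<Sum>i<n. \<Sum>j<n. v i * A $$ (i, j) * v j)" .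
qed (use sym in auto)

text \<open>The quadratic form at \<open>e_i - a * e_j\<close>. With \<open>a = A $$ (i, j)\<close>
  and unit diagonal its value is \<open>1 - a^2\<close>, the test vector that links off-diagonal
  entries of \<open>A\<close> to the diagonal of the inverse.\<close>

lemma sum_pair_indicator:
  fixes F :: "nat \<Rightarrow> nat \<Rightarrow> real"
  assumes "i < n" "j < n" "i \<noteq> j"
  shows "(\<Sum>p<n. \<Sum>q<n. ((if p = i then 1 else 0) - (if p = j then a else 0)) * F p q *
      ((if q = i then 1 else 0) - (if q = j then a else 0))) =
    F i i - a * F i j - a * F j i + a\<^sup>2 * F j j"
proof -
  define w where "w p = (if p = i then 1 else 0) - (if p = j then a else 0)" for p
  have w: "(\<Sum>p<n. w p * g p) = g i - a * g j" for g :: "nat \<Rightarrow> real"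
    using assms by (simp add: w_def left_diff_distrib sum_subtractf if_distrib[of "\<lambda>x. x * _"] cong: if_cong)
  have "(\<Sum>q<n. w p * F p q * w q) = w p * (F p i - a * F p j)" for p
  proof -
    have "(\<Sum>q<n. w p * F p q * w q) = w p * (\<Sum>q<n. w q * F p q)"
      unfolding sum_distrib_left by (intro sum.cong refl) simp
    then show ?thesis by (simp only: w)
  qed
  then have "(\<Sum>p<n. \<Sum>q<n. w p * F p q * w q) = F i i - a * F i j - a * (F j i - a * F j j)"
    by (simp only: w)
  then show ?thesis by (simp add: w_def right_diff_distrib power2_eq_square)
qed

text \<open>If \<open>A = I + X\<close> has unit diagonal and, off the diagonal, \<open>\<bar>A\<^sub>i\<^sub>j\<bar> \<le> e\<close> or \<open>K\<^sub>i\<^sub>j = 0\<close>, then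
  \<open>tr (A K) = n\<close> forces \<open>K\<^sub>i\<^sub>i\<close> to be close to \<open>1\<close>, hence \<open>X\<close> to be small. At the positions with
  \<open>K\<^sub>i\<^sub>j = 0\<close> the identity \<open>X + K - I = X X K\<close> then bounds \<open>X\<close> by its own square, so \<open>X\<close> is bounded
  by \<open>e\<close> everywhere and \<open>K = I - X + O (e\<^sup>2)\<close>.\<close>

lemma inverse_near_identity:
  fixes A :: "real mat"
  assumes A: "A \<in> carrier_mat n n" "positive_definite_mat A"
    and K: "K \<in> carrier_mat n n" "A * K = 1\<^sub>m n"
    and diag: "\<And>i. i < n \<Longrightarrow> A $$ (i, i) = 1"
    and off: "\<And>i j. i < n \<Longrightarrow> j < n \<Longrightarrow> i \<noteq> j \<Longrightarrow> \<bar>A $$ (i, j)\<bar> \<le> e \<or> K $$ (i, j) = 0"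
    and e: "0 < e" "8 * real n ^ 6 * e < 1" "2 * n * e \<le> 1" "2 * (real n)\<^sup>2 * e \<le> 1" and ij: "i < n" "j < n" "i \<noteq> j"
  shows "\<bar>K $$ (i, j) + A $$ (i, j)\<bar> \<le> 2 * (real n)\<^sup>2 * e\<^sup>2"
proof -
  have n: "n > 0" using ij by simp
  have pdK: "positive_definite_mat K" using positive_definite_inverse[OF A K] .
  have Asym: "A $$ (i, j) = A $$ (j, i)" if "i < n" "j < n" for i j
    using A(2)[unfolded positive_definite_mat_iff[OF A(1)]] that by blast
  have Ksym: "K $$ (i, j) = K $$ (j, i)" if "i < n" "j < n" for i j
    using pdK[unfolded positive_definite_mat_iff[OF K(1)]] that by blast
  have AK: "(\<Sum>l<n. A $$ (i, l) * K $$ (l, j)) = (if i = j then 1 else 0)" if "i < n" "j < n" for i j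
    using index_mult_mat_sum[OF A(1) K(1) that] that unfolding K(2) by simp
  have cauchy: "1 \<le> K $$ (i, i) * (1 - (A $$ (i, j))\<^sup>2)" if "i < n" "j < n" "i \<noteq> j" for i j
    using positive_definite_cauchy[OF A K that(1),
        of "\<lambda>p. (if p = i then 1 else 0) - (if p = j then A $$ (i, j) else 0)"] that
    by (simp add: sum_pair_indicator[OF that, of _ "\<lambda>p q. A $$ (p, q)"] diag Asym[of j i] power2_eq_square)
  have Kge1: "K $$ (i, i) \<ge> 1" if "i < n" for i
    using positive_definite_cauchy[OF A K that, of "\<lambda>p. if p = i then 1 else 0"] that
    by (simp add: diag if_distrib[of "\<lambda>x. x * _"] if_distrib[of "\<lambda>x. _ * x"] cong: if_cong)
  define S where "S = (\<Sum>i<n. K $$ (i, i))"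
  have S0: "S \<ge> 0" unfolding S_def using Kge1 by (intro sum_nonneg) (force intro: order_trans[OF zero_le_one])
  have Kb: "\<bar>K $$ (i, j)\<bar> \<le> (K $$ (i, i) + K $$ (j, j)) / 2" if "i < n" "j < n" for i j
    using positive_definite_entry_bound[OF K(1) pdK that] by simp
  \<comment> \<open>The trace of \<open>A K\<close>: diagonal terms contribute
    \<open>K $$ (i, i)\<close>, and off-diagonal terms are 0 or at least \<open>- e\<close> times
    the mean of two diagonal entries of \<open>K\<close>.\<close>
  have "real n = (\<Sum>i<n. \<Sum>l<n. A $$ (i, l) * K $$ (l, i))" by (simp add: AK)
  also have "\<dots> \<ge> (\<Sum>i<n. \<Sum>l<n. (if i = l then K $$ (i, i) else 0) - e * (K $$ (i, i) + K $$ (l, l)) / 2)"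
  proof (intro sum_mono)
    fix i l assume "i \<in> {..<n}" "l \<in> {..<n}"
    then have il: "i < n" "l < n" by auto
    have nn: "0 \<le> e * (K $$ (i, i) + K $$ (l, l)) / 2" using e Kge1[OF il(1)] Kge1[OF il(2)] by simp
    show "(if i = l then K $$ (i, i) else 0) - e * (K $$ (i, i) + K $$ (l, l)) / 2 \<le> A $$ (i, l) * K $$ (l, i)"
    proof (cases "i = l \<or> K $$ (i, l) = 0")
      case True
      then show ?thesis using nn diag il Ksym[OF il] by auto
    next
      case False
      then have "\<bar>A $$ (i, l)\<bar> * \<bar>K $$ (l, i)\<bar> \<le> e * ((K $$ (i, i) + K $$ (l, l)) / 2)"
        using off[OF il] Kb[OF il] Ksym[OF il] e by (intro mult_mono) auto
      then show ?thesis using False by (simp add: abs_mult[symmetric] abs_le_iff)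
    qed
  qed
  also have "(\<Sum>i<n. \<Sum>l<n. (if i = l then K $$ (i, i) else 0) - e * (K $$ (i, i) + K $$ (l, l)) / 2)
      = S - n * e * S"
    by (simp add: sum_subtractf sum.distrib distrib_left add_divide_distrib S_def
        sum_distrib_left[symmetric] sum_divide_distrib[symmetric])
  finally have Sn: "S - n * e * S \<le> n" .
  \<comment> \<open>The crude bound \<open>S \<le> 2 * n\<close> is fed back into \<open>Sn\<close>
    to give a defect \<open>S - n\<close> of order \<open>e\<close>.\<close>
  have "2 * n * e * S \<le> 1 * S" using e(3) S0 by (intro mult_right_mono) auto
  then have S2: "S \<le> 2 * n" using Sn by simp
  have "n * e * S \<le> n * e * (2 * n)" using S2 e by (intro mult_left_mono) auto
  then have Sn2: "S - n \<le> 2 * (real n)\<^sup>2 * e" using Sn by (simp add: power2_eq_square algebra_simps)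
  have K1: "K $$ (i, i) - 1 \<le> 2 * (real n)\<^sup>2 * e" if "i < n" for i
  proof -
    have "K $$ (i, i) - 1 \<le> (\<Sum>i<n. K $$ (i, i) - 1)"
      using that Kge1 by (intro member_le_sum) auto
    also have "\<dots> = S - n" by (simp add: S_def sum_subtractf)
    finally show ?thesis using Sn2 by simp
  qed
  have K2: "\<bar>K $$ (i, j)\<bar> \<le> 2" if "i < n" "j < n" for i j
    using Kb[OF that] K1[OF that(1)] K1[OF that(2)] e(4) by simp
  define X where "X i j = A $$ (i, j) - (if i = j then 1 else 0)" for i j
  \<comment> \<open>By \<open>cauchy\<close>, \<open>(A $$ (i, j))^2\<close> is at most
    \<open>K $$ (i, i) - 1\<close>: an a priori bound of order \<open>sqrt e\<close>.\<close>
  have X2: "(X i j)\<^sup>2 \<le> 2 * (real n)\<^sup>2 * e" if "i < n" "j < n" for i j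
  proof (cases "i = j")
    case True
    then show ?thesis using diag that e by (simp add: X_def)
  next
    case False
    have "(A $$ (i, j))\<^sup>2 * 1 \<le> (A $$ (i, j))\<^sup>2 * K $$ (i, i)"
      using Kge1[OF that(1)] by (intro mult_left_mono) auto
    then show ?thesis using cauchy[OF that False] K1[OF that(1)] False by (simp add: X_def algebra_simps)
  qed
  have XK: "(\<Sum>l<n. X i l * K $$ (l, j)) = (if i = j then 1 else 0) - K $$ (i, j)" if "i < n" "j < n" for i j
    using that AK[OF that]
    by (simp add: X_def left_diff_distrib sum_subtractf if_distrib[of "\<lambda>x. x * _"] cong: if_cong)
  have XXK: "(\<Sum>l<n. X i l * (\<Sum>k<n. X l k * K $$ (k, j))) = X i j + K $$ (i, j)"
    if "i < n" "j < n" "i \<noteq> j" for i j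
  proof -
    have "(\<Sum>l<n. X i l * (\<Sum>k<n. X l k * K $$ (k, j))) =
        (\<Sum>l<n. X i l * (if l = j then 1 else 0)) - (\<Sum>l<n. X i l * K $$ (l, j))"
      using that by (simp add: XK right_diff_distrib sum_subtractf)
    then show ?thesis using that by (simp add: XK if_distrib[of "\<lambda>x. _ * x"] cong: if_cong)
  qed
  define M where "M = Max ((\<lambda>(i, j). \<bar>X i j\<bar>) ` ({..<n} \<times> {..<n}))"
  have fin: "finite ((\<lambda>(i, j). \<bar>X i j\<bar>) ` ({..<n} \<times> {..<n}))" by simp
  have Mge: "\<bar>X i j\<bar> \<le> M" if "i < n" "j < n" for i j
    unfolding M_def using that by (intro Max_ge[OF fin]) auto
  have "M \<in> (\<lambda>(i, j). \<bar>X i j\<bar>) ` ({..<n} \<times> {..<n})"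
    unfolding M_def using n by (intro Max_in[OF fin]) auto
  then obtain a b where ab: "a < n" "b < n" "M = \<bar>X a b\<bar>" by auto
  have M0: "M \<ge> 0" using ab by simp
  have second: "\<bar>X i j + K $$ (i, j)\<bar> \<le> 2 * (real n)\<^sup>2 * M\<^sup>2" if "i < n" "j < n" "i \<noteq> j" for i j
  proof -
    have "\<bar>\<Sum>k<n. X l k * K $$ (k, j)\<bar> \<le> n * (M * 2)" if "l < n" for l
    proof -
      have "\<bar>\<Sum>k<n. X l k * K $$ (k, j)\<bar> \<le> (\<Sum>k<n. \<bar>X l k * K $$ (k, j)\<bar>)" by (rule sum_abs)
      also have "\<dots> \<le> (\<Sum>k<n. M * 2)"
        using that \<open>j < n\<close> by (intro sum_mono) (simp only: abs_mult, intro mult_mono, auto intro: Mge K2 M0)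
      finally show ?thesis by simp
    qed
    then have "\<bar>X i l * (\<Sum>k<n. X l k * K $$ (k, j))\<bar> \<le> M * (n * (M * 2))" if "l < n" for l
      unfolding abs_mult using that \<open>i < n\<close> M0 by (intro mult_mono) (auto intro: Mge)
    then have "(\<Sum>l<n. \<bar>X i l * (\<Sum>k<n. X l k * K $$ (k, j))\<bar>) \<le> (\<Sum>l<n. M * (n * (M * 2)))"
      by (intro sum_mono) simp
    then have "\<bar>\<Sum>l<n. X i l * (\<Sum>k<n. X l k * K $$ (k, j))\<bar> \<le> (\<Sum>l<n. M * (n * (M * 2)))"
      by (rule order_trans[OF sum_abs])
    then show ?thesis unfolding XXK[OF that] by (simp add: power2_eq_square algebra_simps)
  qed
  \<comment> \<open>A maximal entry above \<open>e\<close> sits where \<open>K\<close> vanishes, so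
    \<open>M \<le> 2 * n^2 * M^2\<close>. Hence \<open>M\<close> would be at least
    \<open>1 / (2 * n^2)\<close>, against the a priori bound; squaring and combining the two yields
    the constant \<open>8 * n^6\<close>.\<close>
  have "M \<le> e"
  proof (rule ccontr)
    assume "\<not> M \<le> e"
    then have Me: "M > e" by simp
    then have "X a b \<noteq> 0" using ab e by auto
    then have abne: "a \<noteq> b" using diag ab by (auto simp: X_def)
    then have "K $$ (a, b) = 0" using off[of a b] Me ab by (auto simp: X_def)
    then have "M \<le> 2 * (real n)\<^sup>2 * M\<^sup>2" using second[OF ab(1,2) abne] ab(3) by simp
    then have "1 \<le> 2 * (real n)\<^sup>2 * M" using Me e by (simp add: power2_eq_square)
    then have "1\<^sup>2 \<le> (2 * (real n)\<^sup>2 * M)\<^sup>2" by (intro power_mono) auto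
    also have "\<dots> = 4 * real n ^ 4 * M\<^sup>2" by (simp add: power_mult_distrib power_mult[symmetric])
    also have "\<dots> \<le> 4 * real n ^ 4 * (2 * (real n)\<^sup>2 * e)"
      using X2[OF ab(1,2)] ab(3) by (intro mult_left_mono) auto
    also have "\<dots> = 8 * real n ^ 6 * e" by (simp add: power_add[symmetric])
    finally show False using e(2) by simp
  qed
  then have "2 * (real n)\<^sup>2 * M\<^sup>2 \<le> 2 * (real n)\<^sup>2 * e\<^sup>2" using M0 by (intro mult_left_mono power_mono) auto
  with second[OF ij] have "\<bar>X i j + K $$ (i, j)\<bar> \<le> 2 * (real n)\<^sup>2 * e\<^sup>2" by (rule order_trans)
  then show ?thesis using ij by (simp add: X_def add.commute)
qed

section \<open>Necessity of the pattern condition\<close>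

lemma toeplitz_completions_pattern:
  fixes P :: "nat set"
  assumes P: "P \<subseteq> {1..n - 1}"
    and toep: "\<And>t. pd_completable (partial_toeplitz_mat n P t) \<Longrightarrow>
      toeplitz_mat (max_det_completion (partial_toeplitz_mat n P t))"
    and pq: "p \<in> P" "q \<in> P" "p < q"
  shows "q - p \<in> P \<or> p + q = n"
proof (rule ccontr)
  assume "\<not> ?thesis"
  then have d: "q - p \<notin> P" and ne: "p + q \<noteq> n" by auto
  have pqn: "1 \<le> p" "p < n" "1 \<le> q" "q < n" using subsetD[OF P pq(1)] subsetD[OF P pq(2)] by auto
  then obtain m where m: "n = Suc m" by (cases n) auto
  \<comment> \<open>Chosen so that \<open>8 * n^6 * e\<close> is \<open>1/2\<close> and
    \<open>c = 2 * n^2 * e\<close> is at most \<open>1/8\<close>; this meets all smallness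
    hypotheses of \<open>inverse_near_identity\<close> and the final estimate.\<close>
  define e where "e = 1 / (16 * real n ^ 6)"
  have n1: "real n \<ge> 1" using m by simp
  have pow: "real n ^ k \<le> real n ^ 6" if "k \<le> 6" for k using n1 that by (rule power_increasing[rotated])
  have e0: "e > 0" using n1 by (simp add: e_def)
  have e6: "16 * real n ^ 6 * e = 1" using n1 by (simp add: e_def)
  have ek: "16 * real n ^ k * e \<le> 1" if "k \<le> 6" for k
  proof -
    have "16 * real n ^ k * e \<le> 16 * real n ^ 6 * e" using pow[OF that] e0 by simp
    then show ?thesis using e6 by simp
  qed
  have e1: "16 * n * e \<le> 1" using ek[of 1] by simp
  have e2: "16 * (real n)\<^sup>2 * e \<le> 1" using ek[of 2] by simp
  define t :: "nat \<Rightarrow> real" where "t k = (if k = 0 then 1 else if k = p \<or> k = q then e else 0)" for k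
  define T where "T = partial_toeplitz_mat n P t"
  \<comment> \<open>Filling the unspecified positions with 0 only witnesses that the data are
    completable.\<close>
  define D where "D = mat n n (\<lambda>(i, j). t (index_dist i j))"
  have D: "D \<in> carrier_mat n n" by (simp add: D_def)
  have idx: "index_dist i j = index_dist j i" "index_dist i i = 0" for i j by (auto simp: index_dist_eq)
  have idx0: "index_dist i j = 0 \<longleftrightarrow> i = j" for i j by (auto simp: index_dist_eq)
  have pdD: "positive_definite_mat D"
  proof (rule unit_diagonal_positive_definite[OF D])
    show "n * e < 1" using e1 e0 n1 by simp
  qed (use e0 idx in \<open>auto simp: D_def t_def idx0\<close>)
  have "is_pd_completion T D"
    using pdD by (auto simp: is_pd_completion_def is_completion_def T_def partial_toeplitz_mat_def D_def
        positive_definite_mat_def split: if_splits)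
  then have pdc: "pd_completable T" by (auto simp: pd_completable_def)
  define A where "A = max_det_completion T"
  have toepA: "toeplitz_mat A" using toep[folded T_def] pdc by (simp add: A_def T_def)
  obtain K where pdA: "is_pd_completion T A" and A: "A \<in> carrier_mat n n" "positive_definite_mat A"
    and K: "K \<in> carrier_mat n n" "A * K = 1\<^sub>m n"
    and Kz: "\<And>i j. i < n \<Longrightarrow> j < n \<Longrightarrow> i \<noteq> j \<Longrightarrow> index_dist i j \<notin> P \<Longrightarrow> K $$ (i, j) = 0"
    by (rule partial_toeplitz_max_det[OF pdc[unfolded T_def], folded T_def, folded A_def]) (rule that; assumption)
  have At: "A $$ (i, j) = t (index_dist i j)" if "i < n" "j < n" "i = j \<or> index_dist i j \<in> P" for i j
    using pd_completion_toeplitz_entry[OF pdA[unfolded T_def] that] .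
  define x where "x k = K $$ (k, 0)" for k
  define c where "c = 2 * (real n)\<^sup>2 * e"
  have c: "0 < c" "8 * c \<le> 1" using e0 e2 n1 by (auto simp: c_def)
  have xA: "\<bar>x k + A $$ (k, 0)\<bar> \<le> c * e" if k: "1 \<le> k" "k < n" for k
  proof -
    have "\<bar>K $$ (k, 0) + A $$ (k, 0)\<bar> \<le> 2 * (real n)\<^sup>2 * e\<^sup>2"
    proof (rule inverse_near_identity[OF A K])
      show "A $$ (i, i) = 1" if "i < n" for i using At[of i i] that by (simp add: t_def idx)
      show "\<bar>A $$ (i, j)\<bar> \<le> e \<or> K $$ (i, j) = 0" if "i < n" "j < n" "i \<noteq> j" for i j
        using At[of i j] Kz[of i j] that e0 by (cases "index_dist i j \<in> P") (auto simp: t_def idx0)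
      have "real n ^ 6 * e > 0" using e0 n1 by simp
      then show "8 * real n ^ 6 * e < 1" using e6 by linarith
      show "2 * n * e \<le> 1" using e1 e0 by simp
      show "2 * (real n)\<^sup>2 * e \<le> 1" using c by (simp add: c_def)
    qed (use k e0 in auto)
    then show ?thesis by (simp add: x_def c_def power2_eq_square mult.assoc)
  qed
  have xspec: "\<bar>x k + t k\<bar> \<le> c * e" if "k \<in> P" for k
    using xA[of k] At[of k 0] subsetD[OF P that] that by (auto simp: index_dist_eq)
  have xother: "\<bar>x k\<bar> \<le> c * e" if "1 \<le> k" "k < n" "k \<noteq> p" "k \<noteq> q" for k
  proof (cases "k \<in> P")
    case True
    then show ?thesis using xspec[of k] that by (simp add: t_def)
  next
    case False
    then show ?thesis using Kz[of k 0] that c e0 by (simp add: x_def index_dist_eq)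
  qed
  have xp: "\<bar>x p + e\<bar> \<le> c * e" "\<bar>x q + e\<bar> \<le> c * e"
  proof -
    have "t p = e" "t q = e" using pqn by (simp_all add: t_def)
    then show "\<bar>x p + e\<bar> \<le> c * e" "\<bar>x q + e\<bar> \<le> c * e"
      using xspec[OF pq(1)] xspec[OF pq(2)] by simp_all
  qed
  have xall: "\<bar>x k\<bar> \<le> (1 + c) * e" if "1 \<le> k" "k < n" for k
    using xother[OF that] xp e0 by (cases "k = p \<or> k = q") (auto simp: distrib_right abs_le_iff)
  \<comment> \<open>Position \<open>(m - q, m - p)\<close> and its shift by one both have index
    distance \<open>q - p\<close>, so \<open>K\<close> vanishes at both. Their distances to the last
    and to the first index are \<open>q\<close>, \<open>p\<close> and \<open>n - q\<close>,
    \<open>n - p\<close>.\<close>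
  have prod: "x q * x p = x (n - q) * x (n - p)"
  proof -
    have "K $$ (m - q, m - p) = 0" "K $$ (Suc (m - q), Suc (m - p)) = 0"
    proof -
      have "index_dist (m - q) (m - p) = q - p" "index_dist (Suc (m - q)) (Suc (m - p)) = q - p"
        "m - q \<noteq> m - p" "m - q < n" "m - p < n" "Suc (m - q) < n" "Suc (m - p) < n"
        using pqn pq(3) m by (auto simp: index_dist_eq)
      then show "K $$ (m - q, m - p) = 0" "K $$ (Suc (m - q), Suc (m - p)) = 0" using Kz d by simp_all
    qed
    moreover have "K $$ (0, 0) \<noteq> 0"
      using positive_definite_diag_pos[OF K(1) positive_definite_inverse[OF A K], of 0] m by simp
    ultimately have "K $$ (m - (m - q), 0) * K $$ (m - (m - p), 0) = K $$ (Suc (m - q), 0) * K $$ (Suc (m - p), 0)"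
      using toeplitz_inverse_shift[of A m K "m - q" "m - p"] A K toepA m pqn by simp
    moreover have "m - (m - q) = q" "m - (m - p) = p" "Suc (m - q) = n - q" "Suc (m - p) = n - p"
      using m pqn by auto
    ultimately show ?thesis by (simp add: x_def)
  qed
  \<comment> \<open>Both products are compared at scale \<open>e^2\<close>: the left one is close to
    1, the right one of size \<open>c\<close>. The outcome \<open>1 \<le> 3 * c\<close> contradicts
    \<open>8 * c \<le> 1\<close>.\<close>
  have "((1 - c) * e) * ((1 - c) * e) \<le> \<bar>x q\<bar> * \<bar>x p\<bar>"
  proof (intro mult_mono)
    show "(1 - c) * e \<le> \<bar>x q\<bar>" "(1 - c) * e \<le> \<bar>x p\<bar>"
      using xp unfolding left_diff_distrib by linarith+
  qed (use c e0 in auto)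
  also have "\<dots> = \<bar>x (n - q)\<bar> * \<bar>x (n - p)\<bar>" using prod by (simp add: abs_mult[symmetric])
  also have "\<dots> \<le> (c * e) * ((1 + c) * e)"
  proof -
    \<comment> \<open>If both numbers lay in \<open>{p, q}\<close>, then \<open>p < q\<close> would
      force \<open>n - q = p\<close>, that is \<open>p + q = n\<close>.\<close>
    have "n - q \<notin> {p, q} \<or> n - p \<notin> {p, q}" using ne pqn pq(3) by auto
    then show ?thesis
    proof
      assume "n - q \<notin> {p, q}"
      then show ?thesis using xother[of "n - q"] xall[of "n - p"] pqn c e0 by (intro mult_mono) auto
    next
      assume "n - p \<notin> {p, q}"
      then have "\<bar>x (n - q)\<bar> * \<bar>x (n - p)\<bar> \<le> ((1 + c) * e) * (c * e)"
        using xother[of "n - p"] xall[of "n - q"] pqn c e0 by (intro mult_mono) auto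
      then show ?thesis by (simp only: mult.commute)
    qed
  qed
  finally have "((1 - c) * (1 - c)) * (e * e) \<le> (c * (1 + c)) * (e * e)" by (simp add: mult_ac)
  then have "(1 - c) * (1 - c) \<le> c * (1 + c)" using e0 by simp
  then have "1 \<le> 3 * c" by (simp add: algebra_simps)
  then show False using c by simp
qed

theorem theorem1p1:
  fixes n :: nat and P :: "nat set"
  assumes "n \<ge> 2" and "P \<noteq> {}" and "P \<subseteq> {1..n - 1}"
  shows "(\<forall>t :: nat \<Rightarrow> real. pd_completable (partial_toeplitz_mat n P t) \<longrightarrow>
            toeplitz_mat (max_det_completion (partial_toeplitz_mat n P t)))
     \<longleftrightarrow>
         (\<exists>r k :: nat. r > 0 \<and> k > 0 \<and>
            (P = (\<lambda>j. j * k) ` {1..r}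
             \<or> (P = (\<lambda>j. j * k) ` {1..r - 2} \<union> {r * k} \<and> n = (r + 1) * k)
             \<or> P = {k, n - k}))"
  unfolding pattern_form_iff[OF assms(2,3), symmetric]
  using toeplitz_completions_pattern[OF assms(3)] max_det_completion_toeplitz by blast

end
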